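(* Let $N\ge3$. In the discrete-time sensor model described in the context, let $T_h$ be the second-alarm rule, i.e. the second smallest of the $N$ individual CUSUM alarm times $T^{(1)}_h,\dots,T^{(N)}_h$ with threshold $h>0$. Then the detection delay of $T_h$ scales logarithmically with the average run length: as $h\to\infty$, $$d(T_h)\le\frac{2}{D(f_1\|f_0)}\left(\log\mathrm{ARL}(T_h)+\log\frac{(1-\exp(1-N))R_1^2D(f_1\|f_0)}{\exp(1-N)}+\beta_1+\kappa_1\right)+o(1).$$
   Context: **Model.** Time is integer-valued. There are $N\ge3$ sensors. Sensor $n\in\{1,\dots,N\}$ observes $\xi^{(n)}_k$, $k\ge1$; observations are independent over time and across sensors, with $\xi^{(n)}_k$ having density $f_0$ if $k\le\tau$ and density $f_1$ if $k>\tau$, where $\tau\in\{0,1,2,\dots\}\cup\{\infty\}$ is an unknown deterministic change time ($\tau=\infty$: no change) and $f_0,f_1$ are distinct known densities. One unknown sensor $n^c\in\{1,\dots,N\}$ may be compromised. Sensor $n$ reports $\bar\xi^{(n)}_k$ to a fusion center. If $n$ is honest then $\bar\xi^{(n)}=\xi^{(n)}$; for the compromised sensor, $\bar\xi^{(n^c)}$ is determined by an attack strategy $\mathfrak{s}$, which can use the signal $\xi^{(n^c)}$ observed by the attacker, and on which no assumption is made. Let $\mathcal{F}_k=\sigma\{(\bar\xi^{(1)}_l,\dots,\bar\xi^{(N)}_l):l\le k\}$. It is assumed that $\log\frac{f_1(\xi)}{f_0(\xi)}$ has finite second moment when $\xi\sim f_1$. $D(f_1\|f_0)$ is the Kullback–Leibler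 divergence $\int f_1\log(f_1/f_0)$. $E_{\tau,n^c,\mathfrak{s}}$ denotes expectation when the change occurs at $\tau$, the compromised sensor is $n^c$ and it uses strategy $\mathfrak{s}$. **Performance measures.** For a stopping time $T$ of $(\mathcal{F}_k)$, $$d(T)=\sup_{\tau<\infty,\,n^c,\,\mathfrak{s}}\operatorname{ess\,sup}\,E_{\tau,n^c,\mathfrak{s}}[(T-\tau)^+\mid\mathcal{F}_\tau],\qquad \mathrm{ARL}(T)=\inf_{n^c,\mathfrak{s}}E_{\infty,n^c,\mathfrak{s}}[T].$$ **Second-alarm scheme.** For each $n$ let $$u^{(n)}_k=\sum_{l=1}^k\log\frac{f_1(\bar\xi^{(n)}_l)}{f_0(\bar\xi^{(n)}_l)},\quad m^{(n)}_k=\min_{1\le j\le k}u^{(n)}_j,\quad y^{(n)}_k=u^{(n)}_k-m^{(n)}_k,\quad T^{(n)}_h=\inf\{k\ge1:y^{(n)}_k\ge h\}.$$ $T_h$ is the second order statistic (second smallest value) of $T^{(1)}_h,\dots,T^{(N)}_h$. **Constants.** Consider a single honest sequence $\xi_1,\xi_2,\dots$ i.i.d. with density $f_1$ (change at time $0$), with expectation $E_0$. Put $u_k=\sum_{l=1}^k\log\frac{f_1(\xi_l)}{f_0(\xi_l)}$, $m_k=\min_{1\le j\le k}u_j$, $m_\infty=\inf_{j\ge1}u_j$, $y_k=u_k-m_k$, $T_\nu=\inf\{k\ge1:y_k\ge\nu\}$, $\eta_\nu=\inf\{k\ge 1:u_k\ge\nu\}$. Then $$\kappa_1=\lim_{\nu\to\infty}E_0[y_{T_\nu}-\nu],\qquad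 \beta_1=E_0[m_\infty],\qquad R_1=\lim_{\nu\to\infty}E_0\left[\exp(-(u_{\eta_\nu}-\nu))\right],$$ the limits being assumed to exist. *)

theory Defs
  imports "HOL-Probability.Probability"
begin

text \<open>Natural logarithm with values \<open>-\<infinity>\<close> at \<open>0\<close> and \<open>\<infinity>\<close> at \<open>\<infinity>\<close> (the library's \<open>ln 0 = 0\<close> would
  be wrong for the likelihood ratio at a point where \<open>f\<^sub>1\<close> vanishes).\<close>

definition elog :: "ennreal \<Rightarrow> ereal" where
  "elog x = (if x = 0 then -\<infinity> else if x = \<infinity> then \<infinity> else ereal (ln (enn2real x)))"

definition prob_density :: "'a measure \<Rightarrow> ('a \<Rightarrow> real) \<Rightarrow> bool" where
  "prob_density \<mu> f \<longleftrightarrow> f \<in> borel_measurable \<mu> \<and> (\<forall>x\<in>space \<mu>. 0 \<le> f x) \<and>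
     (\<integral>\<^sup>+x. ennreal (f x) \<partial>\<mu>) = 1"

definition KL :: "'a measure \<Rightarrow> ('a \<Rightarrow> real) \<Rightarrow> ('a \<Rightarrow> real) \<Rightarrow> real" where
  "KL \<mu> f g = (\<integral>x. f x * ln (f x / g x) \<partial>\<mu>)"

text \<open>Densities are taken with respect to a reference measure \<open>\<mu>\<close>.  The signal of one sensor is a
  sequence indexed by the times \<open>{1..}\<close>; the observations of the network are indexed first by the
  sensor \<open>n \<in> {1..N}\<close> and then by time.\<close>

definition seq_space :: "'a measure \<Rightarrow> (nat \<Rightarrow> 'a) measure" where
  "seq_space \<mu> = PiM {1..} (\<lambda>_. \<mu>)"

definition report_space :: "'a measure \<Rightarrow> nat \<Rightarrow> (nat \<Rightarrow> nat \<Rightarrow> 'a) measure" where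
  "report_space \<mu> N = PiM {1..N} (\<lambda>_. seq_space \<mu>)"

definition sensor_law ::
  "'a measure \<Rightarrow> ('a \<Rightarrow> real) \<Rightarrow> ('a \<Rightarrow> real) \<Rightarrow> enat \<Rightarrow> (nat \<Rightarrow> 'a) measure" where
  "sensor_law \<mu> f0 f1 \<tau> =
     PiM {1..} (\<lambda>k. density \<mu> (\<lambda>x. ennreal (if enat k \<le> \<tau> then f0 x else f1 x)))"

definition signal_law ::
  "'a measure \<Rightarrow> ('a \<Rightarrow> real) \<Rightarrow> ('a \<Rightarrow> real) \<Rightarrow> nat \<Rightarrow> enat \<Rightarrow> (nat \<Rightarrow> nat \<Rightarrow> 'a) measure" where
  "signal_law \<mu> f0 f1 N \<tau> = PiM {1..N} (\<lambda>_. sensor_law \<mu> f0 f1 \<tau>)"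

text \<open>An attack strategy maps the signal observed by the attacker to the (distribution of the)
  reported sequence.  It may be randomized and need not be causal; deterministic strategies are the
  kernels \<open>\<lambda>\<xi>. return (seq_space \<mu>) (g \<xi>)\<close>, and an honest sensor is the case \<open>g \<xi> = \<xi>\<close>.\<close>

definition strategies :: "'a measure \<Rightarrow> ((nat \<Rightarrow> 'a) \<Rightarrow> (nat \<Rightarrow> 'a) measure) set" where
  "strategies \<mu> = measurable (seq_space \<mu>) (prob_algebra (seq_space \<mu>))"

text \<open>The law of the reports: the signals \<open>\<xi>\<close> are drawn, and the signal of sensor \<open>nc\<close> is replaced
  by a sequence drawn from \<open>s (\<xi> nc)\<close>.\<close>

definition report_law ::
  "'a measure \<Rightarrow> ('a \<Rightarrow> real) \<Rightarrow> ('a \<Rightarrow> real) \<Rightarrow> nat \<Rightarrow> enat \<Rightarrow> nat \<Rightarrow>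
     ((nat \<Rightarrow> 'a) \<Rightarrow> (nat \<Rightarrow> 'a) measure) \<Rightarrow> (nat \<Rightarrow> nat \<Rightarrow> 'a) measure" where
  "report_law \<mu> f0 f1 N \<tau> nc s =
     signal_law \<mu> f0 f1 N \<tau> \<bind>
       (\<lambda>\<xi>. distr (s (\<xi> nc)) (report_space \<mu> N) (\<lambda>\<zeta>. \<xi>(nc := \<zeta>)))"

definition report_filtration :: "'a measure \<Rightarrow> nat \<Rightarrow> nat \<Rightarrow> (nat \<Rightarrow> nat \<Rightarrow> 'a) measure" where
  "report_filtration \<mu> N k = sigma (space (report_space \<mu> N))
     {(\<lambda>\<omega>. \<omega> n l) -` A \<inter> space (report_space \<mu> N) | n l A. n \<in> {1..N} \<and> l \<in> {1..k} \<and> A \<in> sets \<mu>}"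

text \<open>Subtraction on \<^typ>\<open>enat\<close> is truncated, so \<open>T \<omega> - enat \<tau>\<close> is \<open>(T - \<tau>)\<^sup>+\<close>.\<close>

definition delay ::
  "'a measure \<Rightarrow> ('a \<Rightarrow> real) \<Rightarrow> ('a \<Rightarrow> real) \<Rightarrow> nat \<Rightarrow> ((nat \<Rightarrow> nat \<Rightarrow> 'a) \<Rightarrow> enat) \<Rightarrow> ennreal" where
  "delay \<mu> f0 f1 N T =
     (SUP (\<tau>, nc, s) \<in> (UNIV :: nat set) \<times> {1..N} \<times> strategies \<mu>.
        esssup (report_law \<mu> f0 f1 N (enat \<tau>) nc s)
          (nn_cond_exp (report_law \<mu> f0 f1 N (enat \<tau>) nc s) (report_filtration \<mu> N \<tau>)
             (\<lambda>\<omega>. ennreal_of_enat (T \<omega> - enat \<tau>))))"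

definition ARL ::
  "'a measure \<Rightarrow> ('a \<Rightarrow> real) \<Rightarrow> ('a \<Rightarrow> real) \<Rightarrow> nat \<Rightarrow> ((nat \<Rightarrow> nat \<Rightarrow> 'a) \<Rightarrow> enat) \<Rightarrow> ennreal" where
  "ARL \<mu> f0 f1 N T =
     (INF (nc, s) \<in> {1..N} \<times> strategies \<mu>.
        \<integral>\<^sup>+\<omega>. ennreal_of_enat (T \<omega>) \<partial>report_law \<mu> f0 f1 N \<infinity> nc s)"

definition llr :: "('a \<Rightarrow> real) \<Rightarrow> ('a \<Rightarrow> real) \<Rightarrow> 'a \<Rightarrow> ereal" where
  "llr f0 f1 x = elog (ennreal (f1 x) / ennreal (f0 x))"

definition cusum_u :: "('a \<Rightarrow> real) \<Rightarrow> ('a \<Rightarrow> real) \<Rightarrow> (nat \<Rightarrow> 'a) \<Rightarrow> nat \<Rightarrow> ereal" where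
  "cusum_u f0 f1 \<xi> k = (\<Sum>l=1..k. llr f0 f1 (\<xi> l))"

definition cusum_m :: "('a \<Rightarrow> real) \<Rightarrow> ('a \<Rightarrow> real) \<Rightarrow> (nat \<Rightarrow> 'a) \<Rightarrow> nat \<Rightarrow> ereal" where
  "cusum_m f0 f1 \<xi> k = Min (cusum_u f0 f1 \<xi> ` {1..k})"

text \<open>If \<open>u\<^sub>k = -\<infinity>\<close> (some \<open>f\<^sub>1(\<xi>\<^sub>l) = 0\<close> with \<open>l \<le> k\<close>), then also \<open>m\<^sub>k = -\<infinity>\<close> and \<open>u\<^sub>k - m\<^sub>k\<close> is
  undefined, while \<^typ>\<open>ereal\<close> arithmetic would return \<open>\<infinity>\<close> and raise an alarm.  The statistic is set
  to \<open>0\<close> there.  This does not arise for an honest sensor when \<open>f\<^sub>0\<close> and \<open>f\<^sub>1\<close> have the same support.\<close>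

definition cusum_y :: "('a \<Rightarrow> real) \<Rightarrow> ('a \<Rightarrow> real) \<Rightarrow> (nat \<Rightarrow> 'a) \<Rightarrow> nat \<Rightarrow> ereal" where
  "cusum_y f0 f1 \<xi> k =
     (if cusum_u f0 f1 \<xi> k = -\<infinity> then 0 else cusum_u f0 f1 \<xi> k - cusum_m f0 f1 \<xi> k)"

definition alarm_time :: "('a \<Rightarrow> real) \<Rightarrow> ('a \<Rightarrow> real) \<Rightarrow> real \<Rightarrow> (nat \<Rightarrow> 'a) \<Rightarrow> enat" where
  "alarm_time f0 f1 h \<xi> = Inf {enat k |k. 1 \<le> k \<and> ereal h \<le> cusum_y f0 f1 \<xi> k}"

definition second_alarm ::
  "('a \<Rightarrow> real) \<Rightarrow> ('a \<Rightarrow> real) \<Rightarrow> nat \<Rightarrow> real \<Rightarrow> (nat \<Rightarrow> nat \<Rightarrow> 'a) \<Rightarrow> enat" where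
  "second_alarm f0 f1 N h \<omega> = sort (map (\<lambda>n. alarm_time f0 f1 h (\<omega> n)) [1..<N + 1]) ! 1"

definition passage_time :: "('a \<Rightarrow> real) \<Rightarrow> ('a \<Rightarrow> real) \<Rightarrow> real \<Rightarrow> (nat \<Rightarrow> 'a) \<Rightarrow> enat" where
  "passage_time f0 f1 \<nu> \<xi> = Inf {enat k |k. 1 \<le> k \<and> ereal \<nu> \<le> cusum_u f0 f1 \<xi> k}"

text \<open>Under \<open>sensor_law \<mu> f0 f1 0\<close> the random walk \<open>u\<close> is almost surely finite-valued with positive
  drift, so the passages to \<^typ>\<open>real\<close> and \<^typ>\<open>nat\<close> below only matter on null sets.\<close>

definition mean_excess :: "'a measure \<Rightarrow> ('a \<Rightarrow> real) \<Rightarrow> ('a \<Rightarrow> real) \<Rightarrow> real \<Rightarrow> real" where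
  "mean_excess \<mu> f0 f1 \<nu> =
     (\<integral>\<xi>. real_of_ereal (cusum_y f0 f1 \<xi> (the_enat (alarm_time f0 f1 \<nu> \<xi>))) - \<nu>
        \<partial>sensor_law \<mu> f0 f1 0)"

definition mean_exp_excess :: "'a measure \<Rightarrow> ('a \<Rightarrow> real) \<Rightarrow> ('a \<Rightarrow> real) \<Rightarrow> real \<Rightarrow> real" where
  "mean_exp_excess \<mu> f0 f1 \<nu> =
     (\<integral>\<xi>. exp (- (real_of_ereal (cusum_u f0 f1 \<xi> (the_enat (passage_time f0 f1 \<nu> \<xi>))) - \<nu>))
        \<partial>sensor_law \<mu> f0 f1 0)"

definition mean_min :: "'a measure \<Rightarrow> ('a \<Rightarrow> real) \<Rightarrow> ('a \<Rightarrow> real) \<Rightarrow> real" where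
  "mean_min \<mu> f0 f1 =
     (\<integral>\<xi>. real_of_ereal (INF j\<in>{1..}. cusum_u f0 f1 \<xi> j) \<partial>sensor_law \<mu> f0 f1 0)"

end

theory Submission
  imports Defs
begin

text \<open>Why the bound holds.  Write \<open>D\<close> for the divergence \<open>KL \<mu> f1 f0\<close>, which is positive because the densities
  differ.  A CUSUM chart with threshold \<open>h\<close> fed with post-change data drifts upwards at rate \<open>D\<close>, so it
  needs about \<open>h / D\<close> observations to raise an alarm; fed with pre-change data it raises an alarm
  only once in about \<open>exp h\<close> observations.  At most one sensor is compromised, hence among the
  reports there are two honest charts, and the second alarm comes no later than the later of these two
  and no earlier than the first honest alarm.  Therefore the delay is \<open>h / D + o(h)\<close>, while
  \<open>ln ARL \<ge> h - O(1)\<close>.  The claimed upper bound is thus at least \<open>2 * h / D - O(1)\<close>: the factor \<open>2\<close> leaves room of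
  order \<open>h / D\<close>, which absorbs all additive constants, and the error term can be taken to be \<open>0\<close>.
  It suffices to show that the delay is at most \<open>3/2 * h / D + O(1)\<close>.

  The lower bound on the run length (lemma \<open>ARL_ge\<close>) follows from the Shiryaev-Roberts statistic
  \<open>R (k + 1) = (1 + R k) * L (k + 1)\<close>, where \<open>L\<close> is the likelihood ratio.  While the CUSUM statistic is
  positive, its exponential is dominated by \<open>R\<close>, and before the change its mean grows by at most one per observation, so by
  stopping it and Markov's inequality a chart alarms before time \<open>K\<close> with probability at most
  \<open>K * exp (- h)\<close>; a union bound treats all honest sensors at once.

  The upper bound on the delay (lemma \<open>delay_le\<close>) is a Chernoff bound.  If a chart has not alarmed
  \<open>j + 1\<close> steps after the change, then the last \<open>j\<close> increments sum to less than \<open>h\<close>, whatever the past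
  was, since a CUSUM chart that starts from a past can only be ahead of one that starts afresh.  For a
  suitable \<open>\<theta> > 0\<close> the exponential moment of the increments is at most \<open>exp (- 2/3 * \<theta> * D)\<close>
  (lemma \<open>exponential_moment_bound\<close>), so beyond \<open>3/2 * h / D\<close> steps the probabilities of a missing
  alarm form a convergent geometric series.

  Conditioning on the past of the reports is delicate because the attacker may look into the future of its own
  signal.  The reports of the different sensors are nevertheless independent (lemma
  \<open>report_law_eq_PiM\<close>), so a future observation of an honest sensor is independent of everything
  else; the product formula \<open>nn_integral_mult_fresh\<close> expresses this and drives both bounds.

  All this presumes that honest charts stay finite before the change.  If \<open>f1\<close> vanishes on a set of
  positive \<open>f0\<close>-probability, an honest chart may be stuck at \<open>0\<close> for
  ever.  Then the delay may be infinite, but with positive probability this happens to all honest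
  charts at their first observation, so the average run length is infinite as well
  (lemma \<open>ARL_infinite\<close>).\<close>

section \<open>Resampling one coordinate of a product measure\<close>

text \<open>Replacing one coordinate of a product measure by an independent copy does not change the law.\<close>
lemma nn_integral_PiM_resample:
  assumes prob: "\<And>j. j \<in> I \<Longrightarrow> prob_space (M j)" and i: "i \<in> I"
    and H[measurable]: "H \<in> borel_measurable (PiM I M)"
  shows "(\<integral>\<^sup>+w. H w \<partial>PiM I M) = (\<integral>\<^sup>+w. (\<integral>\<^sup>+x. H (w(i := x)) \<partial>M i) \<partial>PiM I M)"
proof -
  have ins: "insert i I = I" using i by blast
  interpret P: prob_space "PiM I M" by (rule prob_space_PiM) (rule prob)
  interpret Mi: prob_space "M i" by (rule prob[OF i])
  interpret PM: pair_sigma_finite "M i" "PiM I M" ..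
  have [measurable]: "(\<lambda>(x, w). w(i := x)) \<in> M i \<Otimes>\<^sub>M PiM I M \<rightarrow>\<^sub>M PiM I M"
    unfolding split_beta' by (rule measurable_fun_upd[where J = I]) (use i in auto)
  have "(\<integral>\<^sup>+w. H w \<partial>PiM I M)
      = (\<integral>\<^sup>+w. H w \<partial>distr (M i \<Otimes>\<^sub>M PiM I M) (PiM I M) (\<lambda>(x, w). w(i := x)))"
    using distr_pair_PiM_eq_PiM[of I M i] prob i by (simp add: ins)
  also have "\<dots> = (\<integral>\<^sup>+p. H ((\<lambda>(x, w). w(i := x)) p) \<partial>(M i \<Otimes>\<^sub>M PiM I M))"
    by (rule nn_integral_distr) measurable
  also have "\<dots> = (\<integral>\<^sup>+w. (\<integral>\<^sup>+x. H (w(i := x)) \<partial>M i) \<partial>PiM I M)"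
    by (subst PM.nn_integral_snd[symmetric]) (simp_all add: split_beta')
  finally show ?thesis .
qed

text \<open>A coordinate of a coordinate is independent of every function that does not look at it.  The
  outer factor is resampled as a whole, and its component \<open>k\<close> a second time inside.  This two-step form
  allows the remaining outer factors to be arbitrary measures, not products; the law of the
  compromised sensor is of this kind.\<close>
lemma nn_integral_PiM_PiM_mult:
  assumes outer: "\<And>n. n \<in> I \<Longrightarrow> prob_space (M n)" and i: "i \<in> I" and Mi: "M i = PiM J K"
    and inner: "\<And>l. l \<in> J \<Longrightarrow> prob_space (K l)" and k: "k \<in> J"
    and F[measurable]: "F \<in> borel_measurable (PiM I M)" and G[measurable]: "G \<in> borel_measurable (K k)"
    and indep: "\<And>w x. w \<in> space (PiM I M) \<Longrightarrow> x \<in> space (K k) \<Longrightarrow> F (w(i := (w i)(k := x))) = F w"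
  shows "(\<integral>\<^sup>+w. F w * G (w i k) \<partial>PiM I M) = (\<integral>\<^sup>+w. F w \<partial>PiM I M) * (\<integral>\<^sup>+x. G x \<partial>K k)"
proof -
  have [measurable]: "(\<lambda>w. w i k) \<in> PiM I M \<rightarrow>\<^sub>M K k"
  proof -
    have "(\<lambda>w. w i) \<in> PiM I M \<rightarrow>\<^sub>M PiM J K" using measurable_component_singleton[OF i, of M] Mi by simp
    from measurable_compose[OF this measurable_component_singleton[OF k]] show ?thesis .
  qed
  have upd: "(\<lambda>\<xi>. w(i := \<xi>)) \<in> PiM J K \<rightarrow>\<^sub>M PiM I M" if "w \<in> space (PiM I M)" for w
    unfolding Mi[symmetric] by (rule measurable_fun_upd[where J = I]) (use i that in auto)
  have "(\<integral>\<^sup>+w. F w * G (w i k) \<partial>PiM I M)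
      = (\<integral>\<^sup>+w. (\<integral>\<^sup>+\<xi>. F (w(i := \<xi>)) * G (\<xi> k) \<partial>PiM J K) \<partial>PiM I M)"
    by (subst nn_integral_PiM_resample[OF outer i]) (simp_all add: Mi)
  also have "\<dots> = (\<integral>\<^sup>+w. (\<integral>\<^sup>+\<xi>. F (w(i := \<xi>)) \<partial>PiM J K) * (\<integral>\<^sup>+x. G x \<partial>K k) \<partial>PiM I M)"
  proof (rule nn_integral_cong)
    fix w assume w: "w \<in> space (PiM I M)"
    note upd[OF w, measurable]
    have *: "F (w(i := \<xi>(k := x))) = F (w(i := \<xi>))"
      if "\<xi> \<in> space (PiM J K)" "x \<in> space (K k)" for \<xi> x
      using indep[of "w(i := \<xi>)" x] measurable_space[OF upd[OF w] that(1)] that(2) by simp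
    have "(\<integral>\<^sup>+\<xi>. F (w(i := \<xi>)) * G (\<xi> k) \<partial>PiM J K)
      = (\<integral>\<^sup>+\<xi>. (\<integral>\<^sup>+x. F (w(i := \<xi>)) * G x \<partial>K k) \<partial>PiM J K)"
      using k by (subst nn_integral_PiM_resample[OF inner k]) (auto intro!: nn_integral_cong simp: *)
    also have "\<dots> = (\<integral>\<^sup>+\<xi>. F (w(i := \<xi>)) * (\<integral>\<^sup>+x. G x \<partial>K k) \<partial>PiM J K)"
      by (intro nn_integral_cong nn_integral_cmult) simp
    also have "\<dots> = (\<integral>\<^sup>+\<xi>. F (w(i := \<xi>)) \<partial>PiM J K) * (\<integral>\<^sup>+x. G x \<partial>K k)"
      by (intro nn_integral_multc) simp
    finally show "(\<integral>\<^sup>+\<xi>. F (w(i := \<xi>)) * G (\<xi> k) \<partial>PiM J K)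
      = (\<integral>\<^sup>+\<xi>. F (w(i := \<xi>)) \<partial>PiM J K) * (\<integral>\<^sup>+x. G x \<partial>K k)" .
  qed
  also have "\<dots> = (\<integral>\<^sup>+w. (\<integral>\<^sup>+\<xi>. F (w(i := \<xi>)) \<partial>PiM J K) \<partial>PiM I M) * (\<integral>\<^sup>+x. G x \<partial>K k)"
  proof (rule nn_integral_multc)
    interpret Mi: prob_space "PiM J K" using outer[OF i] Mi by simp
    have [measurable]: "(\<lambda>(w, x). w(i := x)) \<in> PiM I M \<Otimes>\<^sub>M PiM J K \<rightarrow>\<^sub>M PiM I M"
      unfolding split_beta' Mi[symmetric]
      by (rule measurable_fun_upd[where J = I]) (use i in auto)
    have "(\<lambda>p. F ((\<lambda>(w, x). w(i := x)) p)) \<in> borel_measurable (PiM I M \<Otimes>\<^sub>M PiM J K)" by measurable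
    then show "(\<lambda>w. \<integral>\<^sup>+\<xi>. F (w(i := \<xi>)) \<partial>PiM J K) \<in> borel_measurable (PiM I M)"
      by (intro Mi.borel_measurable_nn_integral) (simp add: split_beta')
  qed
  also have "(\<integral>\<^sup>+w. (\<integral>\<^sup>+\<xi>. F (w(i := \<xi>)) \<partial>PiM J K) \<partial>PiM I M) = (\<integral>\<^sup>+w. F w \<partial>PiM I M)"
    using nn_integral_PiM_resample[OF outer i F] by (simp add: Mi)
  finally show ?thesis .
qed

section \<open>Paths of the CUSUM statistics and the order statistic of the alarms\<close>

text \<open>Counting the elements below a level is insensitive to sorting; this reduces the second order
  statistic to the existence of two early alarms.\<close>
lemma sort_nth_1_le_iff:
  fixes xs :: "'b::linorder list"
  assumes "2 \<le> length xs"
  shows "sort xs ! 1 \<le> v \<longleftrightarrow> 2 \<le> length (filter (\<lambda>x. x \<le> v) xs)"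
proof -
  obtain a b zs where s: "sort xs = a # b # zs"
    using assms by (metis One_nat_def Suc_1 Suc_le_length_iff length_sort)
  have sorted: "sorted (a # b # zs)"
    using sorted_sort[of xs] s by simp
  have "length (filter (\<lambda>x. x \<le> v) xs) = length (filter (\<lambda>x. x \<le> v) (sort xs))"
    by (simp add: filter_sort)
  also have "2 \<le> \<dots> \<longleftrightarrow> b \<le> v"
  proof (cases "b \<le> v")
    case False
    then have "filter (\<lambda>x. x \<le> v) zs = []"
      using sorted by (fastforce simp: filter_empty_conv)
    then show ?thesis using False s by auto
  qed (use sorted s in auto)
  finally show ?thesis using s by simp
qed

lemma second_alarm_le_iff:
  assumes "2 \<le> N"
  shows "second_alarm f0 f1 N h w \<le> t \<longleftrightarrow>
    (\<exists>i\<in>{1..N}. \<exists>j\<in>{1..N}. i \<noteq> j \<and> alarm_time f0 f1 h (w i) \<le> t \<and> alarm_time f0 f1 h (w j) \<le> t)"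
proof -
  let ?A = "{n \<in> {1..N}. alarm_time f0 f1 h (w n) \<le> t}"
  have "length (filter (\<lambda>x. x \<le> t) (map (\<lambda>n. alarm_time f0 f1 h (w n)) [1..<N + 1]))
      = length (filter (\<lambda>n. alarm_time f0 f1 h (w n) \<le> t) [1..<N + 1])"
    by (simp add: filter_map o_def)
  also have "\<dots> = card (set (filter (\<lambda>n. alarm_time f0 f1 h (w n) \<le> t) [1..<N + 1]))"
    by (rule distinct_card[symmetric]) (rule distinct_filter[OF distinct_upt])
  also have "set (filter (\<lambda>n. alarm_time f0 f1 h (w n) \<le> t) [1..<N + 1]) = ?A"
    by auto
  finally have "second_alarm f0 f1 N h w \<le> t \<longleftrightarrow> 2 \<le> card ?A"
    unfolding second_alarm_def using assms by (subst sort_nth_1_le_iff) auto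
  also have "\<dots> \<longleftrightarrow> (\<exists>i\<in>?A. \<exists>j\<in>?A. i \<noteq> j)"
  proof
    assume "2 \<le> card ?A"
    then obtain B where B: "B \<subseteq> ?A" "card B = 2"
      by (rule obtain_subset_with_card_n)
    then obtain i j where "B = {i, j}" "i \<noteq> j" by (auto simp: card_2_iff)
    with B(1) show "\<exists>i\<in>?A. \<exists>j\<in>?A. i \<noteq> j" by blast
  next
    assume "\<exists>i\<in>?A. \<exists>j\<in>?A. i \<noteq> j"
    then obtain i j where "i \<in> ?A" "j \<in> ?A" "i \<noteq> j" by blast
    then have "card {i, j} \<le> card ?A" by (intro card_mono) auto
    then show "2 \<le> card ?A" using \<open>i \<noteq> j\<close> by simp
  qed
  finally show ?thesis by blast
qed

lemma second_alarm_leI: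
  assumes "i \<in> {1..N}" "j \<in> {1..N}" "i \<noteq> j"
    and "alarm_time f0 f1 h (w i) \<le> t" "alarm_time f0 f1 h (w j) \<le> t"
  shows "second_alarm f0 f1 N h w \<le> t"
proof -
  have "2 \<le> N" using assms(1-3) by auto
  show ?thesis
    unfolding second_alarm_le_iff[OF \<open>2 \<le> N\<close>] using assms by blast
qed

lemma second_alarm_le_imp_honest_alarm:
  assumes "2 \<le> N" "second_alarm f0 f1 N h w \<le> t"
  obtains n where "n \<in> {1..N} - {nc}" "alarm_time f0 f1 h (w n) \<le> t"
proof -
  obtain i j where ij: "i \<in> {1..N}" "j \<in> {1..N}" "i \<noteq> j"
    "alarm_time f0 f1 h (w i) \<le> t" "alarm_time f0 f1 h (w j) \<le> t"
    using assms by (auto simp: second_alarm_le_iff)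
  then show ?thesis using that[of i] that[of j] by (cases "i = nc") auto
qed

lemma alarm_time_le_iff:
  "alarm_time f0 f1 h \<xi> \<le> enat K \<longleftrightarrow> (\<exists>k. 1 \<le> k \<and> k \<le> K \<and> ereal h \<le> cusum_y f0 f1 \<xi> k)"
proof
  let ?S = "{enat k |k. 1 \<le> k \<and> ereal h \<le> cusum_y f0 f1 \<xi> k}"
  assume le: "alarm_time f0 f1 h \<xi> \<le> enat K"
  then have "?S \<noteq> {}" unfolding alarm_time_def Inf_enat_def by (auto split: if_splits)
  then have "Inf ?S \<in> ?S" unfolding Inf_enat_def by (simp only: if_False) (metis (mono_tags) LeastI ex_in_conv)
  with le show "\<exists>k. 1 \<le> k \<and> k \<le> K \<and> ereal h \<le> cusum_y f0 f1 \<xi> k"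
    by (auto simp: alarm_time_def)
next
  assume "\<exists>k. 1 \<le> k \<and> k \<le> K \<and> ereal h \<le> cusum_y f0 f1 \<xi> k"
  then obtain k where k: "1 \<le> k" "k \<le> K" "ereal h \<le> cusum_y f0 f1 \<xi> k" by blast
  then have "alarm_time f0 f1 h \<xi> \<le> enat k"
    unfolding alarm_time_def by (intro Inf_lower) auto
  also have "\<dots> \<le> enat K" using k by simp
  finally show "alarm_time f0 f1 h \<xi> \<le> enat K" .
qed

lemma llr_pos:
  assumes "0 < f0 x" "0 < f1 x"
  shows "llr f0 f1 x = ereal (ln (f1 x / f0 x))"
  using assms by (simp add: llr_def elog_def divide_ennreal)

lemma cusum_u_pos:
  assumes "\<And>l. 1 \<le> l \<Longrightarrow> l \<le> k \<Longrightarrow> 0 < f0 (\<xi> l) \<and> 0 < f1 (\<xi> l)"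
  shows "cusum_u f0 f1 \<xi> k = ereal (\<Sum>l=1..k. ln (f1 (\<xi> l) / f0 (\<xi> l)))"
proof -
  have "cusum_u f0 f1 \<xi> k = (\<Sum>l=1..k. ereal (ln (f1 (\<xi> l) / f0 (\<xi> l))))"
    unfolding cusum_u_def using assms by (intro sum.cong refl llr_pos) auto
  then show ?thesis by simp
qed

text \<open>The minimum in the CUSUM statistic runs over the times \<open>1..k\<close>, so a threshold crossing means that some
  block of increments ending at \<open>k\<close> and starting after time \<open>1\<close> is large.\<close>
lemma le_cusum_y_iff:
  assumes pos: "\<And>l. 1 \<le> l \<Longrightarrow> l \<le> k \<Longrightarrow> 0 < f0 (\<xi> l) \<and> 0 < f1 (\<xi> l)" and k: "1 \<le> k"
  shows "ereal h \<le> cusum_y f0 f1 \<xi> k \<longleftrightarrow>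
    (\<exists>j\<in>{1..k}. h \<le> (\<Sum>l=j+1..k. ln (f1 (\<xi> l) / f0 (\<xi> l))))"
proof -
  define v where "v j = (\<Sum>l=1..j. ln (f1 (\<xi> l) / f0 (\<xi> l)))" for j
  have u: "cusum_u f0 f1 \<xi> j = ereal (v j)" if "j \<le> k" for j
    using that pos unfolding v_def by (intro cusum_u_pos) auto
  have diff: "v k - v j = (\<Sum>l=j+1..k. ln (f1 (\<xi> l) / f0 (\<xi> l)))" if "j \<in> {1..k}" for j
    using that sum.ub_add_nat[of 1 j "\<lambda>l. ln (f1 (\<xi> l) / f0 (\<xi> l))" "k - j"] unfolding v_def by auto
  have "cusum_m f0 f1 \<xi> k = Min (ereal ` v ` {1..k})"
    unfolding cusum_m_def by (intro arg_cong[where f=Min]) (auto simp: u image_image)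
  also have "\<dots> = ereal (Min (v ` {1..k}))"
    using k by (intro mono_Min_commute[symmetric]) (auto simp: mono_def)
  finally have "cusum_y f0 f1 \<xi> k = ereal (v k - Min (v ` {1..k}))"
    by (simp add: cusum_y_def u)
  then have "ereal h \<le> cusum_y f0 f1 \<xi> k \<longleftrightarrow> Min (v ` {1..k}) \<le> v k - h"
    by auto
  also have "\<dots> \<longleftrightarrow> (\<exists>j\<in>{1..k}. v j \<le> v k - h)"
    using k by (subst Min_le_iff) auto
  also have "\<dots> \<longleftrightarrow> (\<exists>j\<in>{1..k}. h \<le> v k - v j)"
    by (intro bex_cong) auto
  also have "\<dots> \<longleftrightarrow> (\<exists>j\<in>{1..k}. h \<le> (\<Sum>l=j+1..k. ln (f1 (\<xi> l) / f0 (\<xi> l))))"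
    using diff by (intro bex_cong refl) simp
  finally show ?thesis .
qed

text \<open>In \<^typ>\<open>ereal\<close> the sum of \<open>\<infinity>\<close> and \<open>-\<infinity>\<close> is \<open>\<infinity>\<close>, which is why \<open>\<infinity>\<close> has to be excluded.\<close>
lemma sum_MInf_ereal:
  fixes f :: "'b \<Rightarrow> ereal"
  assumes "finite A" and "\<And>x. x \<in> A \<Longrightarrow> f x \<noteq> \<infinity>" and "a \<in> A" "f a = -\<infinity>"
  shows "sum f A = -\<infinity>"
proof -
  have "sum f (A - {a}) \<noteq> \<infinity>"
    using assms by (simp add: sum_Pinfty)
  moreover have "sum f A = f a + sum f (A - {a})"
    using assms by (intro sum.remove) auto
  ultimately show ?thesis using assms(4) by (cases "sum f (A - {a})") auto
qed

text \<open>One observation with \<open>f1 = 0\<close> sends the walk to \<open>-\<infinity>\<close>, where it stays; only \<open>f0 > 0\<close> is needed to keep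
  the other increments away from \<open>\<infinity>\<close>.\<close>
lemma alarm_time_infinite:
  assumes "0 < h" and f0: "\<And>l. 1 \<le> l \<Longrightarrow> 0 < f0 (\<xi> l)" and "f1 (\<xi> 1) = 0"
  shows "alarm_time f0 f1 h \<xi> = \<infinity>"
proof -
  have "cusum_y f0 f1 \<xi> k = 0" if k: "1 \<le> k" for k
  proof -
    have "llr f0 f1 (\<xi> l) \<noteq> \<infinity>" if "1 \<le> l" for l
    proof (cases "0 < f1 (\<xi> l)")
      case True
      then show ?thesis using f0[OF that] by (simp add: llr_pos)
    next
      case False
      then show ?thesis by (simp add: llr_def elog_def ennreal_neg)
    qed
    moreover have llr1: "llr f0 f1 (\<xi> 1) = -\<infinity>"
      using assms by (simp add: llr_def elog_def)
    ultimately have "cusum_u f0 f1 \<xi> k = -\<infinity>"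
      unfolding cusum_u_def using k llr1 by (intro sum_MInf_ereal[of _ _ 1]) auto
    then show ?thesis by (simp add: cusum_y_def)
  qed
  then have "{enat k |k. 1 \<le> k \<and> ereal h \<le> cusum_y f0 f1 \<xi> k} = {}"
    using \<open>0 < h\<close> by auto
  then show ?thesis
    unfolding alarm_time_def by (metis Inf_empty top_enat_def)
qed

section \<open>The law of the reports under an attack\<close>

definition obs_law :: "'a measure \<Rightarrow> ('a \<Rightarrow> real) \<Rightarrow> ('a \<Rightarrow> real) \<Rightarrow> enat \<Rightarrow> nat \<Rightarrow> 'a measure" where
  "obs_law \<mu> f0 f1 \<tau> k = density \<mu> (\<lambda>x. ennreal (if enat k \<le> \<tau> then f0 x else f1 x))"

lemma sensor_law_eq_PiM: "sensor_law \<mu> f0 f1 \<tau> = PiM {1..} (obs_law \<mu> f0 f1 \<tau>)"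
  unfolding sensor_law_def obs_law_def[abs_def] ..

lemma obs_law_before: "enat k \<le> \<tau> \<Longrightarrow> obs_law \<mu> f0 f1 \<tau> k = density \<mu> (\<lambda>x. ennreal (f0 x))"
  and obs_law_after: "\<not> enat k \<le> \<tau> \<Longrightarrow> obs_law \<mu> f0 f1 \<tau> k = density \<mu> (\<lambda>x. ennreal (f1 x))"
  by (simp_all add: obs_law_def)

lemma sets_obs_law [simp, measurable_cong]: "sets (obs_law \<mu> f0 f1 \<tau> k) = sets \<mu>"
  and space_obs_law [simp]: "space (obs_law \<mu> f0 f1 \<tau> k) = space \<mu>"
  by (simp_all add: obs_law_def)

lemma prob_space_density_prob_density:
  assumes "prob_density \<mu> f"
  shows "prob_space (density \<mu> (\<lambda>x. ennreal (f x)))"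
  using assms by (intro prob_spaceI) (auto simp: prob_density_def emeasure_density cong: nn_integral_cong)

lemma prob_space_obs_law:
  assumes "prob_density \<mu> f0" "prob_density \<mu> f1"
  shows "prob_space (obs_law \<mu> f0 f1 \<tau> k)"
  using assms prob_space_density_prob_density by (cases "enat k \<le> \<tau>") (auto simp: obs_law_def)

lemma sets_sensor_law [simp, measurable_cong]: "sets (sensor_law \<mu> f0 f1 \<tau>) = sets (seq_space \<mu>)"
  unfolding sensor_law_eq_PiM seq_space_def by (rule sets_PiM_cong) auto

lemma space_sensor_law [simp]: "space (sensor_law \<mu> f0 f1 \<tau>) = space (seq_space \<mu>)"
  by (rule sets_eq_imp_space_eq) simp

lemma prob_space_sensor_law:
  assumes "prob_density \<mu> f0" "prob_density \<mu> f1"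
  shows "prob_space (sensor_law \<mu> f0 f1 \<tau>)"
  unfolding sensor_law_eq_PiM using assms by (intro prob_space_PiM prob_space_obs_law)

text \<open>The law of the report sequence of sensor \<open>n\<close>: averaging the kernel \<open>s\<close> over the signal of the attacker
  gives a fixed law for the compromised sensor.\<close>
definition report_marginal ::
  "'a measure \<Rightarrow> ('a \<Rightarrow> real) \<Rightarrow> ('a \<Rightarrow> real) \<Rightarrow> enat \<Rightarrow> nat \<Rightarrow>
     ((nat \<Rightarrow> 'a) \<Rightarrow> (nat \<Rightarrow> 'a) measure) \<Rightarrow> nat \<Rightarrow> (nat \<Rightarrow> 'a) measure" where
  "report_marginal \<mu> f0 f1 \<tau> nc s n = (if n = nc then sensor_law \<mu> f0 f1 \<tau> \<bind> s else sensor_law \<mu> f0 f1 \<tau>)"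

context
  fixes \<mu> :: "'a measure" and f0 f1 :: "'a \<Rightarrow> real"
    and s :: "(nat \<Rightarrow> 'a) \<Rightarrow> (nat \<Rightarrow> 'a) measure"
  assumes f0: "prob_density \<mu> f0" and f1: "prob_density \<mu> f1" and s: "s \<in> strategies \<mu>"
begin

lemma strategy_measurable [measurable]:
  "s \<in> seq_space \<mu> \<rightarrow>\<^sub>M prob_algebra (seq_space \<mu>)"
  using s by (simp add: strategies_def)

lemma sensor_law_in_prob_algebra: "sensor_law \<mu> f0 f1 \<tau> \<in> space (prob_algebra (seq_space \<mu>))"
  using prob_space_sensor_law[OF f0 f1] by (simp add: space_prob_algebra)

lemma prob_space_report_marginal: "prob_space (report_marginal \<mu> f0 f1 \<tau> nc s n)"
  using prob_space_bind'[OF sensor_law_in_prob_algebra strategy_measurable] prob_space_sensor_law[OF f0 f1]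
  by (simp add: report_marginal_def)

lemma sets_report_marginal [simp, measurable_cong]: "sets (report_marginal \<mu> f0 f1 \<tau> nc s n) = sets (seq_space \<mu>)"
  using sets_bind'[OF sensor_law_in_prob_algebra strategy_measurable] by (simp add: report_marginal_def)

lemma sets_signal_law: "sets (signal_law \<mu> f0 f1 N \<tau>) = sets (report_space \<mu> N)"
  unfolding signal_law_def report_space_def by (rule sets_PiM_cong) auto

text \<open>The signal of the attacker is used to produce its report and is then discarded, so it correlates
  nothing across sensors, even if the strategy is randomized and looks ahead.\<close>
lemma report_law_eq_PiM:
  assumes nc: "nc \<in> {1..N}"
  shows "report_law \<mu> f0 f1 N \<tau> nc s = PiM {1..N} (report_marginal \<mu> f0 f1 \<tau> nc s)"
proof -
  interpret L: product_prob_space "\<lambda>n. report_marginal \<mu> f0 f1 \<tau> nc s n" "{1..N}"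
    by (intro product_prob_spaceI prob_space_report_marginal)
  interpret S: product_prob_space "\<lambda>_. sensor_law \<mu> f0 f1 \<tau>" "{1..N}"
    by (intro product_prob_spaceI prob_space_sensor_law[OF f0 f1])
  have ps: "prob_space (s \<xi>)" and sets_s: "sets (s \<xi>) = sets (seq_space \<mu>)" if "\<xi> \<in> space (seq_space \<mu>)" for \<xi>
    using measurable_space[OF strategy_measurable that] by (auto simp: space_prob_algebra)
  have signal: "signal_law \<mu> f0 f1 N \<tau> \<in> space (prob_algebra (report_space \<mu> N))"
    using S.prob_space_axioms sets_signal_law by (simp add: space_prob_algebra signal_law_def)
  have upd: "(\<lambda>(\<xi>, \<zeta>). \<xi>(nc := \<zeta>)) \<in> report_space \<mu> N \<Otimes>\<^sub>M seq_space \<mu> \<rightarrow>\<^sub>M report_space \<mu> N"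
    unfolding report_space_def split_beta' by (rule measurable_fun_upd[where J = "{1..N}"]) (use nc in auto)
  have comp: "(\<lambda>\<xi>. \<xi> nc) \<in> report_space \<mu> N \<rightarrow>\<^sub>M seq_space \<mu>"
    unfolding report_space_def by (rule measurable_component_singleton[OF nc])
  have kernel: "(\<lambda>\<xi>. distr (s (\<xi> nc)) (report_space \<mu> N) (\<lambda>\<zeta>. \<xi>(nc := \<zeta>)))
      \<in> report_space \<mu> N \<rightarrow>\<^sub>M prob_algebra (report_space \<mu> N)"
    using measurable_distr_prob_space2[OF measurable_compose[OF comp strategy_measurable] upd] .
  have sets_report: "sets (report_law \<mu> f0 f1 N \<tau> nc s) = sets (report_space \<mu> N)"
    unfolding report_law_def by (rule sets_bind'[OF signal kernel])
  show ?thesis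
  proof (rule L.PiM_eqI)
    show "sets (report_law \<mu> f0 f1 N \<tau> nc s) = sets (PiM {1..N} (report_marginal \<mu> f0 f1 \<tau> nc s))"
      unfolding sets_report report_space_def by (rule sets_PiM_cong) auto
  next
    fix A assume "\<And>i. i \<in> {1..N} \<Longrightarrow> A i \<in> sets (report_marginal \<mu> f0 f1 \<tau> nc s i)"
    then have A: "\<And>i. i \<in> {1..N} \<Longrightarrow> A i \<in> sets (seq_space \<mu>)" by simp
    have PA: "Pi\<^sub>E {1..N} A \<in> sets (report_space \<mu> N)"
      unfolding report_space_def using A by (intro sets_PiM_I_finite) auto
    define \<phi> where "\<phi> n = (if n = nc then (\<lambda>\<xi>. emeasure (s \<xi>) (A nc)) else indicator (A n))" for n
    have \<phi>[measurable]: "\<phi> n \<in> borel_measurable (sensor_law \<mu> f0 f1 \<tau>)" if "n \<in> {1..N}" for n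
      using A[OF that] A[OF nc] measurable_prob_algebraD[OF strategy_measurable]
      by (auto simp: \<phi>_def)
    \<comment> \<open>Given the signals, a rectangle has a probability that is a product of functions of the single signals.\<close>
    have "emeasure (report_law \<mu> f0 f1 N \<tau> nc s) (Pi\<^sub>E {1..N} A)
        = (\<integral>\<^sup>+\<xi>. emeasure (distr (s (\<xi> nc)) (report_space \<mu> N) (\<lambda>\<zeta>. \<xi>(nc := \<zeta>))) (Pi\<^sub>E {1..N} A) \<partial>signal_law \<mu> f0 f1 N \<tau>)"
      unfolding report_law_def by (rule emeasure_bind_prob_algebra[OF signal kernel PA])
    also have "\<dots> = (\<integral>\<^sup>+\<xi>. (\<Prod>n\<in>{1..N}. \<phi> n (\<xi> n)) \<partial>signal_law \<mu> f0 f1 N \<tau>)"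
    proof (rule nn_integral_cong)
      fix \<xi> assume "\<xi> \<in> space (signal_law \<mu> f0 f1 N \<tau>)"
      then have \<xi>: "\<xi> \<in> space (report_space \<mu> N)" using sets_eq_imp_space_eq[OF sets_signal_law] by simp
      then have \<xi>nc: "\<xi> nc \<in> space (seq_space \<mu>)" using measurable_space[OF comp] by simp
      have updm: "(\<lambda>\<zeta>. \<xi>(nc := \<zeta>)) \<in> s (\<xi> nc) \<rightarrow>\<^sub>M report_space \<mu> N"
        using measurable_Pair_compose_split[OF upd measurable_const[OF \<xi>] measurable_ident_sets[OF sets_s[OF \<xi>nc]]] by simp
      have "emeasure (distr (s (\<xi> nc)) (report_space \<mu> N) (\<lambda>\<zeta>. \<xi>(nc := \<zeta>))) (Pi\<^sub>E {1..N} A)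
          = emeasure (s (\<xi> nc)) ((\<lambda>\<zeta>. \<xi>(nc := \<zeta>)) -` Pi\<^sub>E {1..N} A \<inter> space (s (\<xi> nc)))"
        by (rule emeasure_distr[OF updm PA])
      also have "(\<lambda>\<zeta>. \<xi>(nc := \<zeta>)) -` Pi\<^sub>E {1..N} A \<inter> space (s (\<xi> nc))
          = (if \<forall>n\<in>{1..N} - {nc}. \<xi> n \<in> A n then A nc else {})"
        using \<xi> nc A[OF nc] sets.sets_into_space[OF A[OF nc]] sets_eq_imp_space_eq[OF sets_s[OF \<xi>nc]]
        by (auto simp: report_space_def space_PiM PiE_iff extensional_def split: if_splits)
      also have "emeasure (s (\<xi> nc)) \<dots> = emeasure (s (\<xi> nc)) (A nc) * (\<Prod>n\<in>{1..N} - {nc}. indicator (A n) (\<xi> n))"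
      proof (cases "\<forall>n\<in>{1..N} - {nc}. \<xi> n \<in> A n")
        case False
        then obtain n where "n \<in> {1..N} - {nc}" "\<xi> n \<notin> A n" by blast
        then have "(\<Prod>n\<in>{1..N} - {nc}. indicator (A n) (\<xi> n) :: ennreal) = 0"
          by (intro prod_zero bexI[of _ n]) auto
        with False show ?thesis by (simp only: if_False) simp
      qed simp
      also have "\<dots> = (\<Prod>n\<in>{1..N}. \<phi> n (\<xi> n))"
        using nc by (subst prod.remove[OF _ nc]) (auto simp: \<phi>_def)
      finally show "emeasure (distr (s (\<xi> nc)) (report_space \<mu> N) (\<lambda>\<zeta>. \<xi>(nc := \<zeta>))) (Pi\<^sub>E {1..N} A)
          = (\<Prod>n\<in>{1..N}. \<phi> n (\<xi> n))" .
    qed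
    also have "\<dots> = (\<Prod>n\<in>{1..N}. \<integral>\<^sup>+\<xi>. \<phi> n \<xi> \<partial>sensor_law \<mu> f0 f1 \<tau>)"
      unfolding signal_law_def by (rule S.product_nn_integral_prod) auto
    also have "\<dots> = (\<Prod>n\<in>{1..N}. emeasure (report_marginal \<mu> f0 f1 \<tau> nc s n) (A n))"
      using A emeasure_bind_prob_algebra[OF sensor_law_in_prob_algebra strategy_measurable A[OF nc]]
      by (intro prod.cong) (auto simp: \<phi>_def report_marginal_def)
    finally show "emeasure (report_law \<mu> f0 f1 N \<tau> nc s) (Pi\<^sub>E {1..N} A)
        = (\<Prod>n\<in>{1..N}. emeasure (report_marginal \<mu> f0 f1 \<tau> nc s n) (A n))" .
  qed simp
qed

end

lemma measurable_report:
  assumes "n \<in> {1..N}" "1 \<le> l"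
  shows "(\<lambda>w. w n l) \<in> report_space \<mu> N \<rightarrow>\<^sub>M \<mu>"
proof -
  have 1: "(\<lambda>w. w n) \<in> report_space \<mu> N \<rightarrow>\<^sub>M seq_space \<mu>"
    unfolding report_space_def by (rule measurable_component_singleton) (use assms in auto)
  have 2: "(\<lambda>\<xi>. \<xi> l) \<in> seq_space \<mu> \<rightarrow>\<^sub>M \<mu>"
    unfolding seq_space_def by (rule measurable_component_singleton) (use assms in auto)
  show ?thesis by (rule measurable_compose[OF 1 2])
qed

lemma report_filtration_generator_sets:
  assumes "n \<in> {1..N}" "l \<in> {1..k}" "A \<in> sets \<mu>"
  shows "(\<lambda>w. w n l) -` A \<inter> space (report_space \<mu> N) \<in> sets (report_space \<mu> N)"
  using assms by (intro measurable_sets[OF measurable_report]) auto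

lemma space_report_filtration [simp]: "space (report_filtration \<mu> N k) = space (report_space \<mu> N)"
  unfolding report_filtration_def by (rule space_measure_of) auto

lemma sets_report_filtration:
  "sets (report_filtration \<mu> N k) = sigma_sets (space (report_space \<mu> N))
     {(\<lambda>w. w n l) -` A \<inter> space (report_space \<mu> N) | n l A. n \<in> {1..N} \<and> l \<in> {1..k} \<and> A \<in> sets \<mu>}"
  unfolding report_filtration_def by (rule sets_measure_of) auto

lemma subalgebra_report_filtration:
  assumes "sets M = sets (report_space \<mu> N)"
  shows "subalgebra M (report_filtration \<mu> N k)"
  unfolding subalgebra_def sets_report_filtration assms
  using sets_eq_imp_space_eq[OF assms]
  by (auto intro!: sets.sigma_sets_subset report_filtration_generator_sets)

text \<open>Measurability with respect to the past is used only through invariance under changes of the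
  future; this passes from generators to the generated \<open>\<sigma>\<close>-algebra.\<close>
lemma report_filtration_depends_on_past:
  assumes "A \<in> sets (report_filtration \<mu> N k)"
    and "w \<in> space (report_space \<mu> N)" "w' \<in> space (report_space \<mu> N)"
    and "\<And>n l. n \<in> {1..N} \<Longrightarrow> l \<in> {1..k} \<Longrightarrow> w n l = w' n l"
  shows "w \<in> A \<longleftrightarrow> w' \<in> A"
  using assms(1) unfolding sets_report_filtration
proof (induction rule: sigma_sets.induct)
  case (Basic A)
  then show ?case using assms(2-4) by auto
qed (use assms(2,3) in auto)

text \<open>Sensor \<open>n\<close> reports its own signal while the attack \<open>s\<close> takes place at another sensor \<open>nc\<close>.\<close>
locale honest_sensor =
  fixes \<mu> :: "'a measure" and f0 f1 :: "'a \<Rightarrow> real" and N nc n :: nat and \<tau> :: enat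
    and s :: "(nat \<Rightarrow> 'a) \<Rightarrow> (nat \<Rightarrow> 'a) measure"
  assumes f0: "prob_density \<mu> f0" and f1: "prob_density \<mu> f1" and s: "s \<in> strategies \<mu>"
    and nc: "nc \<in> {1..N}" and n: "n \<in> {1..N}" and honest: "n \<noteq> nc"
begin

abbreviation P where "P \<equiv> report_law \<mu> f0 f1 N \<tau> nc s"

lemma f_measurable [measurable]: "f0 \<in> borel_measurable \<mu>" "f1 \<in> borel_measurable \<mu>"
  using f0 f1 by (auto simp: prob_density_def)

lemma P_eq: "P = PiM {1..N} (report_marginal \<mu> f0 f1 \<tau> nc s)"
  by (rule report_law_eq_PiM[OF f0 f1 s nc])

lemma prob_space_P: "prob_space P"
  unfolding P_eq by (intro prob_space_PiM prob_space_report_marginal[OF f0 f1 s])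

lemma sets_P [simp, measurable_cong]: "sets P = sets (report_space \<mu> N)"
  unfolding P_eq report_space_def by (rule sets_PiM_cong) (auto simp: sets_report_marginal[OF f0 f1 s])

lemma space_P [simp]: "space P = space (report_space \<mu> N)"
  by (rule sets_eq_imp_space_eq) simp

lemma law_n: "report_marginal \<mu> f0 f1 \<tau> nc s n = PiM {1..} (obs_law \<mu> f0 f1 \<tau>)"
  using honest by (simp add: report_marginal_def sensor_law_eq_PiM)

text \<open>An observation of an honest sensor is independent of all functions of the reports that ignore it.
  The independence assumption is pointwise, so it can be checked by inspecting which coordinates
  \<open>F\<close> mentions.\<close>
lemma nn_integral_mult_fresh:
  assumes k: "1 \<le> k"
    and F: "F \<in> borel_measurable (report_space \<mu> N)" and G: "G \<in> borel_measurable \<mu>"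
    and indep: "\<And>w w'. w \<in> space (report_space \<mu> N) \<Longrightarrow> w' \<in> space (report_space \<mu> N) \<Longrightarrow>
      (\<And>m l. (m, l) \<noteq> (n, k) \<Longrightarrow> w m l = w' m l) \<Longrightarrow> F w = F w'"
  shows "(\<integral>\<^sup>+w. F w * G (w n k) \<partial>P) = (\<integral>\<^sup>+w. F w \<partial>P) * (\<integral>\<^sup>+x. G x \<partial>obs_law \<mu> f0 f1 \<tau> k)"
  unfolding P_eq
proof (rule nn_integral_PiM_PiM_mult[where J = "{1..}"])
  show "F \<in> borel_measurable (PiM {1..N} (report_marginal \<mu> f0 f1 \<tau> nc s))"
    using F measurable_cong_sets[OF sets_P refl] unfolding P_eq by blast
  show "G \<in> borel_measurable (obs_law \<mu> f0 f1 \<tau> k)"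
    using G by (simp cong: measurable_cong_sets)
  fix w x assume w: "w \<in> space (PiM {1..N} (report_marginal \<mu> f0 f1 \<tau> nc s))"
    and x: "x \<in> space (obs_law \<mu> f0 f1 \<tau> k)"
  then have w: "w \<in> space (report_space \<mu> N)" using space_P unfolding P_eq by blast
  have "w(n := (w n)(k := x)) \<in> space (report_space \<mu> N)"
    using w x n k by (auto simp: report_space_def seq_space_def space_PiM PiE_iff extensional_def)
  then show "F (w(n := (w n)(k := x))) = F w"
    using w by (intro indep) auto
qed (use n k prob_space_report_marginal[OF f0 f1 s] law_n prob_space_obs_law[OF f0 f1] in auto)

lemma AE_all_reports:
  assumes "\<And>l. 1 \<le> l \<Longrightarrow> AE x in obs_law \<mu> f0 f1 \<tau> l. Q x"
  shows "AE w in P. \<forall>l\<ge>1. Q (w n l)"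
proof -
  have "AE w in P. l \<ge> 1 \<longrightarrow> Q (w n l)" for l
  proof (cases "1 \<le> l")
    case True
    have "AE \<xi> in report_marginal \<mu> f0 f1 \<tau> nc s n. Q (\<xi> l)"
      unfolding law_n using True assms[OF True] prob_space_obs_law[OF f0 f1] by (intro AE_PiM_component) auto
    then have "AE w in P. Q (w n l)"
      unfolding P_eq using n prob_space_report_marginal[OF f0 f1 s]
      by (intro AE_PiM_component[where P = "\<lambda>\<xi>. Q (\<xi> l)"]) auto
    then show ?thesis by simp
  qed simp
  then show ?thesis by (simp add: AE_all_countable)
qed

end

section \<open>The average run length grows exponentially in the threshold\<close>

text \<open>The Shiryaev-Roberts statistic, stopped at its first passage above \<open>c\<close>.  Stopping the process itself replaces an optional
  stopping argument: a passage before time \<open>K\<close> is visible in the single variable at time \<open>K\<close>.\<close>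
primrec stopped_SR :: "('a \<Rightarrow> real) \<Rightarrow> ('a \<Rightarrow> real) \<Rightarrow> ennreal \<Rightarrow> (nat \<Rightarrow> 'a) \<Rightarrow> nat \<Rightarrow> ennreal" where
  "stopped_SR f0 f1 c \<xi> 0 = 0"
| "stopped_SR f0 f1 c \<xi> (Suc k) =
     (if c \<le> stopped_SR f0 f1 c \<xi> k then stopped_SR f0 f1 c \<xi> k
      else (1 + stopped_SR f0 f1 c \<xi> k) * ennreal (f1 (\<xi> (Suc k)) / f0 (\<xi> (Suc k))))"

lemma stopped_SR_cong:
  assumes "\<And>l. 1 \<le> l \<Longrightarrow> l \<le> k \<Longrightarrow> \<xi> l = \<xi>' l"
  shows "stopped_SR f0 f1 c \<xi> k = stopped_SR f0 f1 c \<xi>' k"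
  using assms by (induction k) auto

lemma stopped_SR_stays:
  assumes "c \<le> stopped_SR f0 f1 c \<xi> k" "k \<le> K"
  shows "c \<le> stopped_SR f0 f1 c \<xi> K"
  using assms(2,1) by (induction K rule: dec_induct) auto

text \<open>Each likelihood ratio of a block \<open>{j+1..k}\<close> is a summand of the Shiryaev-Roberts statistic at time
  \<open>k\<close>, and a CUSUM alarm means that one of these ratios is at least \<open>exp h\<close>.\<close>
lemma alarm_imp_stopped_SR:
  assumes h: "0 < h" and alarm: "alarm_time f0 f1 h \<xi> \<le> enat K"
    and pos: "\<And>l. 1 \<le> l \<Longrightarrow> 0 < f0 (\<xi> l) \<and> 0 < f1 (\<xi> l)"
  shows "ennreal (exp h) \<le> stopped_SR f0 f1 (ennreal (exp h)) \<xi> K"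
proof (rule ccontr)
  let ?S = "stopped_SR f0 f1 (ennreal (exp h)) \<xi>"
  let ?L = "\<lambda>l. f1 (\<xi> l) / f0 (\<xi> l)"
  assume "\<not> ennreal (exp h) \<le> ?S K"
  then have running: "\<not> ennreal (exp h) \<le> ?S k" if "k \<le> K" for k
    using that stopped_SR_stays by blast
  obtain k j where k: "k \<le> K" "j \<in> {1..k}" and hj: "h \<le> (\<Sum>l=j+1..k. ln (?L l))"
    using alarm pos unfolding alarm_time_le_iff by (auto simp: le_cusum_y_iff)
  have Lpos: "0 < ?L l" if "1 \<le> l" for l using pos[OF that] by simp
  \<comment> \<open>The empty block has sum \<open>0 < h\<close>, so the alarm is not raised by it.\<close>
  have "j < k" using h hj k(2) by (cases "j = k") auto
  have "ennreal (\<Prod>l=j+1..m. ?L l) \<le> ?S m" if "j + 1 \<le> m" "m \<le> k" for m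
    using that
  proof (induction m rule: dec_induct)
    case base
    then show ?case using running[of j] k by (auto intro: order_trans[OF _ mult_right_mono, of _ 1])
  next
    case (step m)
    have "0 \<le> (\<Prod>l=j+1..m. ?L l)"
      using Lpos by (intro prod_nonneg less_imp_le) auto
    moreover have "0 \<le> ?L (Suc m)"
      using Lpos[of "Suc m"] by simp
    ultimately have "ennreal (\<Prod>l=j+1..Suc m. ?L l) = ennreal (\<Prod>l=j+1..m. ?L l) * ennreal (?L (Suc m))"
      using step.hyps by (subst ennreal_mult[symmetric]) simp_all
    also have "\<dots> \<le> (1 + ?S m) * ennreal (?L (Suc m))"
      using step by (intro mult_right_mono) (auto intro: add_increasing)
    also have "\<dots> = ?S (Suc m)"
      using running[of m] step k by simp
    finally show ?case .
  qed
  from this[of k] have "ennreal (\<Prod>l=j+1..k. ?L l) \<le> ?S k" using \<open>j < k\<close> by simp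
  moreover have "exp h \<le> (\<Prod>l=j+1..k. ?L l)"
  proof -
    have "exp h \<le> exp (\<Sum>l=j+1..k. ln (?L l))" using hj by simp
    also have "\<dots> = (\<Prod>l=j+1..k. ?L l)"
      using Lpos by (subst exp_sum) (auto intro!: prod.cong)
    finally show ?thesis .
  qed
  ultimately show False
    using running[OF k(1)] ennreal_leI order_trans by blast
qed

lemma (in honest_sensor) measurable_stopped_SR [measurable]:
  "(\<lambda>w. stopped_SR f0 f1 c (w n) k) \<in> borel_measurable (report_space \<mu> N)"
proof (induction k)
  case (Suc k)
  note Suc[measurable]
  have [measurable]: "(\<lambda>w. w n (Suc k)) \<in> report_space \<mu> N \<rightarrow>\<^sub>M \<mu>"
    using n by (intro measurable_report) auto
  show ?case unfolding stopped_SR.simps by measurable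
qed simp

text \<open>Under \<open>f0\<close> the likelihood ratio has mean at most one; mass of \<open>f1\<close> where \<open>f0\<close> vanishes is lost.\<close>
lemma (in honest_sensor) nn_integral_likelihood_ratio_le:
  assumes "enat k \<le> \<tau>"
  shows "(\<integral>\<^sup>+x. ennreal (f1 x / f0 x) \<partial>obs_law \<mu> f0 f1 \<tau> k) \<le> 1"
proof -
  have "(\<integral>\<^sup>+x. ennreal (f1 x / f0 x) \<partial>obs_law \<mu> f0 f1 \<tau> k)
      = (\<integral>\<^sup>+x. ennreal (f0 x) * ennreal (f1 x / f0 x) \<partial>\<mu>)"
    using assms by (simp add: obs_law_before nn_integral_density)
  also have "\<dots> \<le> (\<integral>\<^sup>+x. ennreal (f1 x) \<partial>\<mu>)"
  proof (rule nn_integral_mono)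
    fix x assume "x \<in> space \<mu>"
    then have "0 \<le> f0 x" "0 \<le> f1 x" using f0 f1 by (auto simp: prob_density_def)
    then have "ennreal (f0 x) * ennreal (f1 x / f0 x) = ennreal (f0 x * (f1 x / f0 x))"
      by (intro ennreal_mult[symmetric]) auto
    also have "\<dots> \<le> ennreal (f1 x)"
      using \<open>0 \<le> f1 x\<close> by (intro ennreal_leI) simp
    finally show "ennreal (f0 x) * ennreal (f1 x / f0 x) \<le> ennreal (f1 x)" .
  qed
  also have "\<dots> = 1" using f1 by (simp add: prob_density_def)
  finally show ?thesis .
qed

text \<open>As long as it is running, the statistic grows by at most one in mean, since the new likelihood
  ratio is independent of it and has mean at most one.\<close>
lemma (in honest_sensor) nn_integral_stopped_SR_le:
  assumes "enat k \<le> \<tau>"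
  shows "(\<integral>\<^sup>+w. stopped_SR f0 f1 c (w n) k \<partial>P) \<le> of_nat k"
  using assms
proof (induction k)
  case (Suc k)
  define S where "S w = stopped_SR f0 f1 c (w n) k" for w :: "nat \<Rightarrow> nat \<Rightarrow> 'a"
  \<comment> \<open>\<open>A\<close> is the stopped and \<open>B\<close> the running part of the statistic.\<close>
  define A where "A w = (if c \<le> S w then S w else 0)" for w
  define B where "B w = (if c \<le> S w then 0 else 1 + S w)" for w
  define L where "L x = ennreal (f1 x / f0 x)" for x
  interpret P: prob_space P by (rule prob_space_P)
  have le: "enat k \<le> \<tau>" using Suc.prems by (meson enat_ord_simps(1) lessI less_imp_le_nat order_trans)
  have S: "S \<in> borel_measurable (report_space \<mu> N)"
    unfolding S_def by (rule measurable_stopped_SR)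
  then have A: "A \<in> borel_measurable (report_space \<mu> N)" and B: "B \<in> borel_measurable (report_space \<mu> N)"
    unfolding A_def B_def by measurable
  have L: "L \<in> borel_measurable \<mu>" unfolding L_def by measurable
  have "(\<lambda>w. w n (Suc k)) \<in> report_space \<mu> N \<rightarrow>\<^sub>M \<mu>"
    using n by (intro measurable_report) auto
  from measurable_compose[OF this L]
  have Lk: "(\<lambda>w. L (w n (Suc k))) \<in> borel_measurable (report_space \<mu> N)" .
  have meas: "f \<in> borel_measurable P" if "f \<in> borel_measurable (report_space \<mu> N)" for f :: "_ \<Rightarrow> ennreal"
    using that by (simp cong: measurable_cong_sets)
  have "(\<integral>\<^sup>+w. stopped_SR f0 f1 c (w n) (Suc k) \<partial>P) = (\<integral>\<^sup>+w. A w + B w * L (w n (Suc k)) \<partial>P)"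
    by (intro nn_integral_cong) (simp add: A_def B_def S_def L_def)
  also have "\<dots> = (\<integral>\<^sup>+w. A w \<partial>P) + (\<integral>\<^sup>+w. B w * L (w n (Suc k)) \<partial>P)"
    by (intro nn_integral_add meas A borel_measurable_times_ennreal B Lk)
  also have "(\<integral>\<^sup>+w. B w * L (w n (Suc k)) \<partial>P) = (\<integral>\<^sup>+w. B w \<partial>P) * (\<integral>\<^sup>+x. L x \<partial>obs_law \<mu> f0 f1 \<tau> (Suc k))"
  proof (rule nn_integral_mult_fresh[OF _ B L])
    fix w w' :: "nat \<Rightarrow> nat \<Rightarrow> 'a"
    assume "\<And>m l. (m, l) \<noteq> (n, Suc k) \<Longrightarrow> w m l = w' m l"
    then have "S w = S w'" unfolding S_def by (intro stopped_SR_cong) auto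
    then show "B w = B w'" by (simp add: B_def)
  qed simp
  also have "\<dots> \<le> (\<integral>\<^sup>+w. B w \<partial>P) * 1"
    unfolding L_def by (intro mult_left_mono nn_integral_likelihood_ratio_le Suc.prems) simp
  also have "(\<integral>\<^sup>+w. A w \<partial>P) + (\<integral>\<^sup>+w. B w \<partial>P) * 1 = (\<integral>\<^sup>+w. A w + B w \<partial>P)"
    by (simp add: nn_integral_add meas A B)
  also have "\<dots> \<le> (\<integral>\<^sup>+w. 1 + S w \<partial>P)"
    by (intro nn_integral_mono) (simp add: A_def B_def)
  also have "\<dots> = (\<integral>\<^sup>+w. 1 \<partial>P) + (\<integral>\<^sup>+w. S w \<partial>P)"
    by (intro nn_integral_add meas S) simp
  also have "(\<integral>\<^sup>+w. 1 \<partial>P) = 1"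
    using P.emeasure_space_1 by simp
  also have "1 + (\<integral>\<^sup>+w. S w \<partial>P) \<le> of_nat (Suc k)"
    using Suc.IH[OF le] unfolding S_def by (simp add: add_left_mono)
  finally show ?case by (simp add: add_left_mono)
qed simp

lemma (in honest_sensor) prob_stopped_SR_le:
  assumes "enat k \<le> \<tau>" and c: "0 < c"
  shows "measure P {w \<in> space P. ennreal c \<le> stopped_SR f0 f1 (ennreal c) (w n) k} \<le> k / c"
proof -
  let ?B = "{w \<in> space P. ennreal c \<le> stopped_SR f0 f1 (ennreal c) (w n) k}"
  interpret P: prob_space P by (rule prob_space_P)
  have "ennreal (c * measure P ?B) = (\<integral>\<^sup>+w. ennreal c * indicator ?B w \<partial>P)"
    using c by (subst nn_integral_cmult_indicator) (auto simp: ennreal_mult P.emeasure_eq_measure)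
  also have "\<dots> \<le> (\<integral>\<^sup>+w. stopped_SR f0 f1 (ennreal c) (w n) k \<partial>P)"
    by (intro nn_integral_mono) (auto split: split_indicator)
  also have "\<dots> \<le> of_nat k" by (rule nn_integral_stopped_SR_le[OF assms(1)])
  also have "\<dots> = ennreal (real k)" by (simp add: ennreal_of_nat_eq_real_of_nat)
  finally show ?thesis using c by (simp add: field_simps)
qed

text \<open>Before \<open>K\<close> each honest chart alarms with probability at most \<open>K / exp h\<close>, so with probability at
  least \<open>1/2\<close> none does, and then the second alarm cannot have occurred either.\<close>
lemma nn_integral_second_alarm_ge:
  assumes N: "2 \<le> N" and f0: "prob_density \<mu> f0" and f1: "prob_density \<mu> f1"
    and supp: "AE x in \<mu>. 0 < f0 x \<longrightarrow> 0 < f1 x"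
    and nc: "nc \<in> {1..N}" and s: "s \<in> strategies \<mu>"
    and h: "0 < h" and K: "2 * real N * real K \<le> exp h"
  shows "ennreal (K / 2) \<le> (\<integral>\<^sup>+w. ennreal_of_enat (second_alarm f0 f1 N h w) \<partial>report_law \<mu> f0 f1 N \<infinity> nc s)"
proof -
  define P where "P = report_law \<mu> f0 f1 N \<infinity> nc s"
  define c where "c = ennreal (exp h)"
  define H where "H = {1..N} - {nc}"
  have honest: "honest_sensor \<mu> f0 f1 N nc n s" if "n \<in> H" for n
    using that f0 f1 s nc by unfold_locales (auto simp: H_def)
  have "finite H" by (auto simp: H_def)
  have "card H \<le> N"
    using card_mono[of "{1..N}" H] by (auto simp: H_def)
  have "\<exists>n. n \<in> H"
    using N nc unfolding H_def by (intro exI[of _ "if nc = 1 then 2 else 1"]) auto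
  then obtain n0 where n0: "n0 \<in> H" ..
  interpret n0: honest_sensor \<mu> f0 f1 N nc n0 \<infinity> s by (rule honest[OF n0])
  interpret P: prob_space P unfolding P_def by (rule n0.prob_space_P)
  define B where "B n = {w \<in> space P. c \<le> stopped_SR f0 f1 c (w n) K}" for n
  have B_sets: "B n \<in> sets P" if "n \<in> H" for n
  proof -
    interpret honest_sensor \<mu> f0 f1 N nc n \<infinity> s by (rule honest[OF that])
    have "(\<lambda>w. stopped_SR f0 f1 c (w n) K) \<in> borel_measurable P"
      unfolding P_def using measurable_stopped_SR by (simp cong: measurable_cong_sets)
    then show ?thesis unfolding B_def by measurable
  qed
  have B_prob: "measure P (B n) \<le> K / exp h" if "n \<in> H" for n
  proof -
    interpret honest_sensor \<mu> f0 f1 N nc n \<infinity> s by (rule honest[OF that])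
    show ?thesis
      unfolding B_def c_def P_def by (rule prob_stopped_SR_le) auto
  qed
  have "measure P (\<Union>n\<in>H. B n) \<le> (\<Sum>n\<in>H. measure P (B n))"
    using \<open>finite H\<close> B_sets by (intro P.finite_measure_subadditive_finite) auto
  also have "\<dots> \<le> (\<Sum>n\<in>H. K / exp h)" by (intro sum_mono B_prob)
  also have "\<dots> \<le> N * (K / exp h)"
    using \<open>card H \<le> N\<close> by (simp add: divide_right_mono mult_right_mono)
  also have "\<dots> \<le> 1 / 2" using K by (simp add: field_simps)
  finally have UB: "measure P (\<Union>n\<in>H. B n) \<le> 1 / 2" .
  have U: "(\<Union>n\<in>H. B n) \<in> sets P" using \<open>finite H\<close> B_sets by auto
  define G where "G = space P - (\<Union>n\<in>H. B n)"
  have G: "G \<in> sets P" "1 / 2 \<le> measure P G"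
    using U UB P.prob_compl[OF U] unfolding G_def by auto
  have obs_law: "obs_law \<mu> f0 f1 \<infinity> k = density \<mu> (\<lambda>x. ennreal (f0 x))" for k
    by (rule obs_law_before) simp
  have AE_good: "AE w in P. \<forall>n\<in>H. \<forall>l\<ge>1. 0 < f0 (w n l) \<and> 0 < f1 (w n l)"
  proof (rule AE_finite_allI[OF \<open>finite H\<close>])
    fix n assume "n \<in> H"
    then interpret honest_sensor \<mu> f0 f1 N nc n \<infinity> s by (rule honest)
    show "AE w in P. \<forall>l\<ge>1. 0 < f0 (w n l) \<and> 0 < f1 (w n l)"
      unfolding P_def
    proof (rule AE_all_reports)
      fix l :: nat
      show "AE x in obs_law \<mu> f0 f1 \<infinity> l. 0 < f0 x \<and> 0 < f1 x"
        unfolding obs_law by (subst AE_density) (use supp in \<open>auto elim: eventually_mono\<close>)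
    qed
  qed
  have "ennreal (K / 2) \<le> ennreal (K * measure P G)"
    using mult_left_mono[OF G(2), of "real K"] by (intro ennreal_leI) simp
  also have "\<dots> = (\<integral>\<^sup>+w. ennreal K * indicator G w \<partial>P)"
    using G(1) by (subst nn_integral_cmult_indicator) (auto simp: ennreal_mult P.emeasure_eq_measure)
  also have "\<dots> \<le> (\<integral>\<^sup>+w. ennreal_of_enat (second_alarm f0 f1 N h w) \<partial>P)"
  proof (rule nn_integral_mono_AE)
    show "AE w in P. ennreal K * indicator G w \<le> ennreal_of_enat (second_alarm f0 f1 N h w)"
      using AE_good AE_space
    proof eventually_elim
      case (elim w)
      show ?case
      proof (cases "w \<in> G")
        case True
        have late: "\<not> alarm_time f0 f1 h (w n) \<le> enat K" if "n \<in> H" for n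
        proof
          assume "alarm_time f0 f1 h (w n) \<le> enat K"
          from alarm_imp_stopped_SR[OF h this] elim that
          have "c \<le> stopped_SR f0 f1 c (w n) K" by (simp add: c_def)
          with that True show False by (auto simp: G_def B_def)
        qed
        have "\<not> second_alarm f0 f1 N h w \<le> enat K"
          by (rule notI, erule second_alarm_le_imp_honest_alarm[OF N, where nc = nc])
            (use late in \<open>simp add: H_def\<close>)
        then have "enat K \<le> second_alarm f0 f1 N h w" by simp
        then have "ennreal_of_enat (enat K) \<le> ennreal_of_enat (second_alarm f0 f1 N h w)"
          by (simp only: ennreal_of_enat_le_iff)
        with True show ?thesis by (simp add: ennreal_of_nat_eq_real_of_nat)
      qed simp
    qed
  qed
  finally show ?thesis unfolding P_def .
qed

text \<open>The choice \<open>K = \<lfloor>exp h / (2 * N)\<rfloor>\<close> in the previous lemma; rounding costs a factor \<open>2\<close> once \<open>exp h / (2 * N) \<ge> 2\<close>.\<close>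
lemma ARL_ge:
  assumes N: "2 \<le> N" and f0: "prob_density \<mu> f0" and f1: "prob_density \<mu> f1"
    and supp: "AE x in \<mu>. 0 < f0 x \<longrightarrow> 0 < f1 x" and h: "0 < h" "4 * real N \<le> exp h"
  shows "ennreal (exp h / (8 * real N)) \<le> ARL \<mu> f0 f1 N (second_alarm f0 f1 N h)"
proof -
  define K where "K = nat \<lfloor>exp h / (2 * real N)\<rfloor>"
  have Npos: "0 < real N" using N by simp
  have ge: "0 \<le> exp h / (2 * real N)" by simp
  have "real K \<le> exp h / (2 * real N)" "exp h / (2 * real N) - 1 < real K"
    unfolding K_def using ge by linarith+
  moreover have "2 \<le> exp h / (2 * real N)" using h(2) Npos by (simp add: field_simps)
  ultimately have K: "2 * real N * real K \<le> exp h" "exp h / (8 * real N) \<le> real K / 2"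
    using Npos by (simp_all add: field_simps)
  have "ennreal (exp h / (8 * real N)) \<le> ennreal (real K / 2)"
    using K(2) by (rule ennreal_leI)
  also have "\<dots> \<le> ARL \<mu> f0 f1 N (second_alarm f0 f1 N h)"
    unfolding ARL_def using nn_integral_second_alarm_ge[OF N f0 f1 supp _ _ h(1) K(1)]
    by (intro INF_greatest) auto
  finally show ?thesis .
qed

text \<open>With positive probability all honest sensors start with an observation where \<open>f1\<close> vanishes, and
  then at most one alarm is ever raised.\<close>
lemma ARL_infinite:
  assumes N: "2 \<le> N" and f0: "prob_density \<mu> f0" and f1: "prob_density \<mu> f1"
    and supp: "\<not> (AE x in \<mu>. 0 < f0 x \<longrightarrow> 0 < f1 x)" and h: "0 < h"
  shows "ARL \<mu> f0 f1 N (second_alarm f0 f1 N h) = \<infinity>"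
proof -
  have "(\<integral>\<^sup>+w. ennreal_of_enat (second_alarm f0 f1 N h w) \<partial>report_law \<mu> f0 f1 N \<infinity> nc s) = \<infinity>"
    if nc: "nc \<in> {1..N}" and s: "s \<in> strategies \<mu>" for nc s
  proof -
    define P where "P = report_law \<mu> f0 f1 N \<infinity> nc s"
    define H where "H = {1..N} - {nc}"
    have honest: "honest_sensor \<mu> f0 f1 N nc n s" if "n \<in> H" for n
      using that f0 f1 s nc by unfold_locales (auto simp: H_def)
    have "finite H" by (auto simp: H_def)
    have "\<exists>n. n \<in> H"
      using N nc unfolding H_def by (intro exI[of _ "if nc = 1 then 2 else 1"]) auto
    then obtain n0 where n0: "n0 \<in> H" ..
    interpret n0: honest_sensor \<mu> f0 f1 N nc n0 \<infinity> s by (rule honest[OF n0])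
    interpret P: prob_space P unfolding P_def by (rule n0.prob_space_P)
    interpret L: product_prob_space "report_marginal \<mu> f0 f1 \<infinity> nc s" "{1..N}"
      by (intro product_prob_spaceI prob_space_report_marginal[OF f0 f1 s])
    interpret O: product_prob_space "obs_law \<mu> f0 f1 \<infinity>" "{1..}"
      by (intro product_prob_spaceI prob_space_obs_law[OF f0 f1])
    define Z where "Z = {x \<in> space \<mu>. f1 x = 0}"
    have Z: "Z \<in> sets \<mu>" unfolding Z_def by measurable
    define D where "D = {\<xi> \<in> space (seq_space \<mu>). \<xi> 1 \<in> Z}"
    have D_eq: "D = {\<xi> \<in> space (PiM {1..} (obs_law \<mu> f0 f1 \<infinity>)). \<xi> 1 \<in> Z}"
      using space_sensor_law[of \<mu> f0 f1 \<infinity>] unfolding D_def sensor_law_eq_PiM by simp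
    have D: "D \<in> sets (seq_space \<mu>)"
      unfolding D_def seq_space_def using Z by measurable
    have D_law: "emeasure (PiM {1..} (obs_law \<mu> f0 f1 \<infinity>)) D = emeasure (obs_law \<mu> f0 f1 \<infinity> 1) Z"
      unfolding D_eq using Z by (intro O.emeasure_PiM_Collect_single) auto
    have obs_law: "obs_law \<mu> f0 f1 \<infinity> k = density \<mu> (\<lambda>x. ennreal (f0 x))" for k
      by (rule obs_law_before) simp
    \<comment> \<open>A null set here would mean that \<open>f1\<close> is positive wherever \<open>f0\<close> is, up to a null set.\<close>
    have Zpos: "emeasure (obs_law \<mu> f0 f1 \<infinity> 1) Z \<noteq> 0"
    proof
      assume "emeasure (obs_law \<mu> f0 f1 \<infinity> 1) Z = 0"
      then have "AE x in obs_law \<mu> f0 f1 \<infinity> 1. x \<notin> Z"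
        using Z by (intro AE_not_in) auto
      then have "AE x in \<mu>. 0 < f0 x \<longrightarrow> x \<notin> Z"
        unfolding obs_law by (subst (asm) AE_density) auto
      then have "AE x in \<mu>. 0 < f0 x \<longrightarrow> 0 < f1 x"
        using AE_space
      proof eventually_elim
        case (elim x)
        moreover have "0 \<le> f1 x" using f1 elim(2) by (auto simp: prob_density_def)
        ultimately show ?case by (auto simp: Z_def)
      qed
      with supp show False ..
    qed
    define G where "G = {w \<in> space P. \<forall>n\<in>H. w n \<in> D}"
    have "emeasure P G = (\<Prod>n\<in>H. emeasure (report_marginal \<mu> f0 f1 \<infinity> nc s n) D)"
      unfolding G_def P_def n0.P_eq using D \<open>finite H\<close> H_def
      by (intro L.emeasure_PiM_Collect) (auto simp: sets_report_marginal[OF f0 f1 s])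
    also have "\<dots> \<noteq> 0"
      using \<open>finite H\<close> Zpos D_law by (auto simp: report_marginal_def H_def sensor_law_eq_PiM)
    finally have Gpos: "emeasure P G \<noteq> 0" .
    then have G: "G \<in> sets P" using emeasure_neq_0_sets by blast
    have AE_good: "AE w in P. \<forall>n\<in>H. \<forall>l\<ge>1. 0 < f0 (w n l)"
    proof (rule AE_finite_allI[OF \<open>finite H\<close>])
      fix n assume "n \<in> H"
      then interpret honest_sensor \<mu> f0 f1 N nc n \<infinity> s by (rule honest)
      show "AE w in P. \<forall>l\<ge>1. 0 < f0 (w n l)"
        unfolding P_def by (rule AE_all_reports) (unfold obs_law, subst AE_density, auto)
    qed
    have "\<infinity> = (\<integral>\<^sup>+w. \<infinity> * indicator G w \<partial>P)"
      using G Gpos by (subst nn_integral_cmult_indicator) (auto simp: ennreal_top_mult)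
    also have "\<dots> \<le> (\<integral>\<^sup>+w. ennreal_of_enat (second_alarm f0 f1 N h w) \<partial>P)"
    proof (rule nn_integral_mono_AE)
      show "AE w in P. \<infinity> * indicator G w \<le> ennreal_of_enat (second_alarm f0 f1 N h w)"
        using AE_good
      proof eventually_elim
        case (elim w)
        show ?case
        proof (cases "w \<in> G")
          case True
          have never: "alarm_time f0 f1 h (w n) = \<infinity>" if "n \<in> H" for n
            using h elim that True by (intro alarm_time_infinite) (auto simp: G_def D_def Z_def)
          have "\<not> second_alarm f0 f1 N h w \<le> enat k" for k
            by (rule notI, erule second_alarm_le_imp_honest_alarm[OF N, where nc = nc])
              (use never in \<open>simp add: H_def\<close>)
          then have "second_alarm f0 f1 N h w = \<infinity>"
            by (cases "second_alarm f0 f1 N h w") auto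
          then show ?thesis by simp
        qed simp
      qed
    qed
    finally show ?thesis unfolding P_def by (simp add: top_unique)
  qed
  then show ?thesis
    unfolding ARL_def using N by (auto intro!: antisym INF_greatest simp: infinity_ennreal_def)
qed

section \<open>Exponential moments of the log-likelihood ratio\<close>

text \<open>A domination, uniform in \<open>m\<close>, of the difference quotients of \<open>exp (- t * a)\<close> at \<open>t = 0\<close>.  For \<open>a < 0\<close> it is Bernoulli's
  inequality \<open>1 + m * y \<le> (1 + y) ^ m\<close> with \<open>(1 + y) ^ m = exp (- a)\<close>.\<close>
lemma scaled_one_minus_exp_bound:
  fixes a :: real
  assumes "1 \<le> m"
  shows "\<bar>real m * (1 - exp (- (a / real m)))\<bar> \<le> \<bar>a\<bar> + exp (- a)"
proof (cases "0 \<le> a")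
  case True
  have m: "0 < real m" using assms by simp
  have "1 - exp (- (a / m)) \<le> a / m"
    using exp_ge_add_one_self[of "- (a / m)"] by simp
  then have "real m * (1 - exp (- (a / m))) \<le> real m * (a / m)"
    using m by (intro mult_left_mono) auto
  moreover have "0 \<le> real m * (1 - exp (- (a / m)))"
    using True m by simp
  ultimately show ?thesis using True m by (simp add: add_increasing2)
next
  case False
  have m: "0 < real m" using assms by simp
  define y where "y = exp (- (a / m)) - 1"
  have y: "0 \<le> y" using False m by (simp add: y_def divide_nonpos_pos)
  have "1 + real m * y \<le> (1 + y) ^ m"
    using y by (intro Bernoulli_inequality) simp
  also have "\<dots> = exp (- a)"
    using m by (simp add: y_def exp_of_nat_mult[symmetric])
  finally have "real m * y \<le> exp (- a)" by simp
  then show ?thesis using y m by (simp add: y_def abs_mult)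
qed

lemma scaled_one_minus_exp_tendsto:
  fixes a :: real
  shows "(\<lambda>m. real (Suc m) * (1 - exp (- (a / real (Suc m))))) \<longlonglongrightarrow> a"
proof -
  have "((\<lambda>t. exp (- (a * t))) has_real_derivative - a) (at 0)"
    by (auto intro!: derivative_eq_intros)
  then have "((\<lambda>t. (exp (- (a * t)) - 1) / t) \<longlongrightarrow> - a) (at 0)"
    by (simp add: has_field_derivative_iff)
  moreover have "filterlim (\<lambda>m. inverse (real (Suc m))) (at 0) sequentially"
    using LIMSEQ_inverse_real_of_nat by (simp add: filterlim_at)
  ultimately have "(\<lambda>m. (exp (- (a * inverse (real (Suc m)))) - 1) / inverse (real (Suc m))) \<longlonglongrightarrow> - a"
    by (rule filterlim_compose)
  from tendsto_minus[OF this] show ?thesis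
    by (simp add: field_simps)
qed

lemma exp_eq_add_one_imp_zero:
  fixes t :: real
  assumes "exp t = 1 + t"
  shows "t = 0"
proof -
  have "ln (exp t) = exp t - 1"
    unfolding ln_exp using assms by linarith
  then have "exp t = 1" by (intro ln_eq_minus_one) auto
  then show ?thesis by simp
qed

locale llr_moments =
  fixes \<mu> :: "'a measure" and f0 f1 :: "'a \<Rightarrow> real"
  assumes f0: "prob_density \<mu> f0" and f1: "prob_density \<mu> f1"
    and moment: "(\<integral>\<^sup>+x. e2ennreal ((llr f0 f1 x)\<^sup>2) \<partial>density \<mu> (\<lambda>x. ennreal (f1 x))) < \<infinity>"
begin

abbreviation g where "g x \<equiv> ln (f1 x / f0 x)"
abbreviation M1 where "M1 \<equiv> density \<mu> (\<lambda>x. ennreal (f1 x))"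

lemma f_meas [measurable]: "f0 \<in> borel_measurable \<mu>" "f1 \<in> borel_measurable \<mu>"
  using f0 f1 by (auto simp: prob_density_def)

lemma f_nonneg: "x \<in> space \<mu> \<Longrightarrow> 0 \<le> f0 x" "x \<in> space \<mu> \<Longrightarrow> 0 \<le> f1 x"
  using f0 f1 by (auto simp: prob_density_def)

lemma prob_space_M1: "prob_space M1"
  by (rule prob_space_density_prob_density[OF f1])

text \<open>Where \<open>f0\<close> vanishes and \<open>f1\<close> does not, the squared log-likelihood ratio is infinite, so the second
  moment forces this set to be null.\<close>
lemma AE_f0_pos: "AE x in \<mu>. 0 < f1 x \<longrightarrow> 0 < f0 x"
proof -
  define B where "B = {x \<in> space \<mu>. 0 < f1 x \<and> f0 x = 0}"
  have B: "B \<in> sets \<mu>" unfolding B_def by measurable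
  have "\<infinity> * emeasure M1 B = (\<integral>\<^sup>+x. \<infinity> * indicator B x \<partial>M1)"
    using B by (subst nn_integral_cmult_indicator) auto
  also have "\<dots> \<le> (\<integral>\<^sup>+x. e2ennreal ((llr f0 f1 x)\<^sup>2) \<partial>M1)"
  proof (rule nn_integral_mono)
    fix x
    show "\<infinity> * indicator B x \<le> e2ennreal ((llr f0 f1 x)\<^sup>2)"
    proof (cases "x \<in> B")
      case True
      then have "ennreal (f1 x) / ennreal (f0 x) = \<infinity>"
        by (simp add: B_def divide_ennreal_def ennreal_mult_top)
      then have "llr f0 f1 x = \<infinity>" by (simp add: llr_def elog_def)
      then show ?thesis by (simp add: power2_eq_square)
    qed simp
  qed
  also have "\<dots> < \<infinity>" by (rule moment)
  finally have "emeasure M1 B = 0" by (cases "emeasure M1 B = 0") (auto simp: ennreal_top_mult)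
  then have "AE x in M1. x \<notin> B" using B by (intro AE_not_in) auto
  then have "AE x in \<mu>. 0 < f1 x \<longrightarrow> x \<notin> B" by (subst (asm) AE_density) auto
  then show ?thesis
    using AE_space
  proof eventually_elim
    case (elim x)
    with f_nonneg(1)[of x] show ?case by (auto simp: B_def)
  qed
qed

lemma AE_M1_pos: "AE x in M1. 0 < f0 x \<and> 0 < f1 x"
  by (subst AE_density) (use AE_f0_pos in auto)

lemma integrable_g: "integrable M1 g"
proof -
  interpret M1: prob_space M1 by (rule prob_space_M1)
  have "(\<integral>\<^sup>+x. ennreal ((g x)\<^sup>2) \<partial>M1) = (\<integral>\<^sup>+x. e2ennreal ((llr f0 f1 x)\<^sup>2) \<partial>M1)"
  proof (rule nn_integral_cong_AE)
    show "AE x in M1. ennreal ((g x)\<^sup>2) = e2ennreal ((llr f0 f1 x)\<^sup>2)"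
      using AE_M1_pos
    proof eventually_elim
      case (elim x)
      then have "llr f0 f1 x = ereal (g x)" by (intro llr_pos) auto
      then show ?case by (simp only: power2_eq_square times_ereal.simps e2ennreal_ereal)
    qed
  qed
  also have "\<dots> < \<infinity>" by (rule moment)
  finally have fin: "(\<integral>\<^sup>+x. ennreal ((g x)\<^sup>2) \<partial>M1) < \<infinity>" .
  have meas: "g \<in> borel_measurable M1" by measurable
  have "(\<lambda>x. (g x)\<^sup>2) \<in> borel_measurable M1" by measurable
  then have "integrable M1 (\<lambda>x. (g x)\<^sup>2)"
    by (rule integrableI_nonneg) (use fin in \<open>simp_all only: zero_le_power2 eventually_True\<close>)
  then show ?thesis
    by (rule M1.square_integrable_imp_integrable[OF meas])
qed

lemma KL_eq: "KL \<mu> f1 f0 = (\<integral>x. g x \<partial>M1)"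
  unfolding KL_def by (subst integral_density) (auto intro!: AE_I2 f_nonneg)

text \<open>Changing the measure from \<open>f1\<close> to \<open>f0\<close>: the inverse likelihood ratio integrates to the \<open>f0\<close>-mass of
  the support of \<open>f1\<close>.\<close>
lemma nn_integral_exp_minus_g: "(\<integral>\<^sup>+x. ennreal (exp (- g x)) \<partial>M1) = (\<integral>\<^sup>+x. ennreal (f0 x) * indicator {x. 0 < f1 x} x \<partial>\<mu>)"
proof -
  have "(\<integral>\<^sup>+x. ennreal (exp (- g x)) \<partial>M1) = (\<integral>\<^sup>+x. ennreal (f1 x) * ennreal (exp (- g x)) \<partial>\<mu>)"
    by (subst nn_integral_density) auto
  also have "\<dots> = (\<integral>\<^sup>+x. ennreal (f0 x) * indicator {x. 0 < f1 x} x \<partial>\<mu>)"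
  proof (rule nn_integral_cong_AE)
    show "AE x in \<mu>. ennreal (f1 x) * ennreal (exp (- g x)) = ennreal (f0 x) * indicator {x. 0 < f1 x} x"
      using AE_f0_pos AE_space
    proof eventually_elim
      case (elim x)
      show ?case
      proof (cases "0 < f1 x")
        case True
        then have "f1 x * exp (- g x) = f0 x"
          using elim by (simp add: exp_minus)
        then show ?thesis using True by (simp add: ennreal_mult''[symmetric])
      qed (use f_nonneg(2)[OF elim(2)] in auto)
    qed
  qed
  finally show ?thesis .
qed

lemma nn_integral_exp_minus_g_le: "(\<integral>\<^sup>+x. ennreal (exp (- g x)) \<partial>M1) \<le> 1"
proof -
  have "(\<integral>\<^sup>+x. ennreal (exp (- g x)) \<partial>M1) \<le> (\<integral>\<^sup>+x. ennreal (f0 x) \<partial>\<mu>)"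
    unfolding nn_integral_exp_minus_g by (intro nn_integral_mono) (auto split: split_indicator)
  then show ?thesis using f0 by (simp add: prob_density_def)
qed

lemma integrable_exp_minus_g: "integrable M1 (\<lambda>x. exp (- g x))"
  using nn_integral_exp_minus_g_le
  by (intro integrableI_bounded) (auto intro: le_less_trans)

text \<open>Gibbs' inequality with its equality case.  The function \<open>exp (- t) - 1 + t\<close> is nonnegative and vanishes
  only at \<open>t = 0\<close>.  Its mean at the log-likelihood ratio is at most \<open>D\<close>; so \<open>D \<le> 0\<close> gives \<open>f0 = f1\<close> on the
  support of \<open>f1\<close>, where \<open>f0\<close> then has all its mass.\<close>
lemma KL_pos:
  assumes "\<not> (AE x in \<mu>. f0 x = f1 x)"
  shows "0 < KL \<mu> f1 f0"
proof (rule ccontr)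
  interpret M1: prob_space M1 by (rule prob_space_M1)
  assume "\<not> 0 < KL \<mu> f1 f0"
  define \<psi> where "\<psi> x = exp (- g x) - 1 + g x" for x
  have \<psi>_nonneg: "0 \<le> \<psi> x" for x
    unfolding \<psi>_def using exp_ge_add_one_self[of "- g x"] by simp
  have \<psi>_int: "integrable M1 \<psi>"
    unfolding \<psi>_def using integrable_g integrable_exp_minus_g by simp
  have exp_int: "(\<integral>x. exp (- g x) \<partial>M1) \<le> 1"
    using nn_integral_exp_minus_g_le nn_integral_eq_integral[OF integrable_exp_minus_g] by simp
  have "(\<integral>x. \<psi> x \<partial>M1) = (\<integral>x. exp (- g x) \<partial>M1) - 1 + KL \<mu> f1 f0"
    unfolding \<psi>_def KL_eq using integrable_g integrable_exp_minus_g
    by (simp add: M1.prob_space[simplified])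
  then have "(\<integral>x. \<psi> x \<partial>M1) \<le> 0"
    using exp_int \<open>\<not> 0 < KL \<mu> f1 f0\<close> by linarith
  moreover have "0 \<le> (\<integral>x. \<psi> x \<partial>M1)"
    by (rule Bochner_Integration.integral_nonneg) (rule \<psi>_nonneg)
  ultimately have "(\<integral>x. \<psi> x \<partial>M1) = 0" by (rule antisym)
  then have "AE x in M1. \<psi> x = 0"
    using \<psi>_int \<psi>_nonneg by (subst (asm) integral_nonneg_eq_0_iff_AE) auto
  then have "AE x in M1. f0 x = f1 x"
    using AE_M1_pos
  proof eventually_elim
    case (elim x)
    have "exp (- g x) = 1 + - g x"
      using elim(1) unfolding \<psi>_def by linarith
    then have "- g x = 0" by (rule exp_eq_add_one_imp_zero)
    then show ?case using elim(2) by simp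
  qed
  then have eq: "AE x in \<mu>. 0 < f1 x \<longrightarrow> f0 x = f1 x" by (subst (asm) AE_density) auto
  have "(\<integral>\<^sup>+x. ennreal (f0 x) * indicator {x. 0 < f1 x} x \<partial>\<mu>) = (\<integral>\<^sup>+x. ennreal (f1 x) \<partial>\<mu>)"
  proof (rule nn_integral_cong_AE)
    show "AE x in \<mu>. ennreal (f0 x) * indicator {x. 0 < f1 x} x = ennreal (f1 x)"
      using eq
    proof eventually_elim
      case (elim x)
      then show ?case by (cases "0 < f1 x") (simp_all add: ennreal_neg)
    qed
  qed
  also have "\<dots> = 1" using f1 by (simp add: prob_density_def)
  finally have one: "(\<integral>\<^sup>+x. ennreal (f0 x) * indicator {x. 0 < f1 x} x \<partial>\<mu>) = 1" .
  have "1 + (\<integral>\<^sup>+x. ennreal (f0 x) * indicator {x. f1 x \<le> 0} x \<partial>\<mu>)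
      = (\<integral>\<^sup>+x. ennreal (f0 x) * indicator {x. 0 < f1 x} x + ennreal (f0 x) * indicator {x. f1 x \<le> 0} x \<partial>\<mu>)"
    by (subst nn_integral_add) (auto simp: one)
  also have "\<dots> = (\<integral>\<^sup>+x. ennreal (f0 x) \<partial>\<mu>)"
    by (intro nn_integral_cong) (auto split: split_indicator)
  also have "\<dots> = 1 + 0" using f0 by (simp add: prob_density_def)
  finally have "(\<integral>\<^sup>+x. ennreal (f0 x) * indicator {x. f1 x \<le> 0} x \<partial>\<mu>) = 0"
    by (simp only: ennreal_add_left_cancel) simp
  then have "AE x in \<mu>. ennreal (f0 x) * indicator {x. f1 x \<le> 0} x = 0"
    by (subst (asm) nn_integral_0_iff_AE) auto
  then have "AE x in \<mu>. f0 x = f1 x"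
    using eq AE_space
  proof eventually_elim
    case (elim x)
    show ?case
    proof (cases "0 < f1 x")
      case False
      then have "f0 x \<le> 0" using elim(1) by (simp add: ennreal_eq_0_iff)
      then show ?thesis using False f_nonneg[OF elim(3)] by linarith
    qed (use elim(2) in simp)
  qed
  with assms show False ..
qed

text \<open>The derivative of the Laplace transform of the log-likelihood ratio at \<open>0\<close> is \<open>- D\<close>, by dominated
  convergence of the difference quotients.  Any factor below \<open>1\<close> in front of \<open>D\<close> would do here; it has to
  exceed \<open>1/2\<close> to beat the factor \<open>2\<close> in the final bound.\<close>
lemma exponential_moment_bound:
  assumes D: "0 < KL \<mu> f1 f0"
  obtains \<theta> where "0 < \<theta>"
    "(\<integral>\<^sup>+x. ennreal (exp (- \<theta> * g x)) \<partial>M1) \<le> ennreal (exp (- (2 / 3) * \<theta> * KL \<mu> f1 f0))"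
proof -
  interpret M1: prob_space M1 by (rule prob_space_M1)
  let ?D = "KL \<mu> f1 f0"
  define q where "q m x = real (Suc m) * (1 - exp (- (g x / real (Suc m))))" for m x
  have q_bound: "\<bar>q m x\<bar> \<le> \<bar>g x\<bar> + exp (- g x)" for m x
    unfolding q_def by (rule scaled_one_minus_exp_bound) simp
  have dom: "integrable M1 (\<lambda>x. \<bar>g x\<bar> + exp (- g x))"
    using integrable_g integrable_exp_minus_g by simp
  have q_meas: "q m \<in> borel_measurable M1" for m
    unfolding q_def by measurable
  have lim: "(\<lambda>m. \<integral>x. q m x \<partial>M1) \<longlonglongrightarrow> (\<integral>x. g x \<partial>M1)"
  proof (rule integral_dominated_convergence[OF _ q_meas dom])
    show "AE x in M1. (\<lambda>m. q m x) \<longlonglongrightarrow> g x"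
      unfolding q_def by (intro AE_I2 scaled_one_minus_exp_tendsto)
  qed (use q_bound in auto)
  have q_int: "integrable M1 (q m)" for m
    using q_bound[of m] by (intro Bochner_Integration.integrable_bound[OF dom q_meas] AE_I2) (simp add: order_trans[OF _ abs_ge_self])
  have "2 / 3 * ?D < (\<integral>x. g x \<partial>M1)" using D by (simp add: KL_eq)
  then have "eventually (\<lambda>m. 2 / 3 * ?D < (\<integral>x. q m x \<partial>M1)) sequentially"
    using lim by (rule order_tendstoD(1)[rotated])
  then obtain m where m: "2 / 3 * ?D < (\<integral>x. q m x \<partial>M1)"
    by (meson eventually_happens trivial_limit_sequentially)
  define \<theta> where "\<theta> = 1 / real (Suc m)"
  have \<theta>: "0 < \<theta>" by (simp add: \<theta>_def)
  have e: "exp (- \<theta> * g x) = 1 - \<theta> * q m x" for x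
    by (simp add: \<theta>_def q_def)
  have int: "integrable M1 (\<lambda>x. exp (- \<theta> * g x))"
    unfolding e using q_int by simp
  have "(\<integral>x. exp (- \<theta> * g x) \<partial>M1) = 1 - \<theta> * (\<integral>x. q m x \<partial>M1)"
    unfolding e using q_int by (simp add: M1.prob_space[simplified])
  also have "\<dots> \<le> 1 - \<theta> * (2 / 3 * ?D)"
    using m \<theta> by simp
  also have "\<dots> \<le> exp (- (2 / 3) * \<theta> * ?D)"
    using exp_ge_add_one_self[of "- (2 / 3) * \<theta> * ?D"] by (simp add: field_simps)
  finally have "(\<integral>\<^sup>+x. ennreal (exp (- \<theta> * g x)) \<partial>M1) \<le> ennreal (exp (- (2 / 3) * \<theta> * ?D))"
    using nn_integral_eq_integral[OF int] by (simp add: ennreal_leI)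
  with \<theta> show ?thesis by (rule that)
qed

end

section \<open>The worst-case detection delay\<close>

text \<open>A bound on the averages over all events of the sub-\<open>\<sigma>\<close>-algebra bounds the conditional
  expectation.  A nonmeasurable \<open>f\<close> has conditional expectation \<open>0\<close> by convention, so the bound on the averages is only
  required for measurable \<open>f\<close>.\<close>
lemma nn_cond_exp_le_const:
  assumes M: "finite_measure M" and sub: "subalgebra M F" and c: "c < \<infinity>"
    and le: "\<And>A. f \<in> borel_measurable M \<Longrightarrow> A \<in> sets F \<Longrightarrow>
      (\<integral>\<^sup>+x. indicator A x * f x \<partial>M) \<le> c * emeasure M A"
  shows "AE x in M. nn_cond_exp M F f x \<le> c"
proof (cases "f \<in> borel_measurable M")
  case True
  interpret finite_measure M by (rule M)
  interpret sigma_finite_subalgebra M F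
    by (intro finite_measure_subalgebra_is_sigma_finite)
      (simp add: finite_measure_subalgebra_def finite_measure_subalgebra_axioms_def M sub)
  define C where "C = nn_cond_exp M F f"
  have CF: "C \<in> borel_measurable F" and CM: "C \<in> borel_measurable M"
    unfolding C_def by measurable
  have spaceF: "space F = space M" using sub by (simp add: subalgebra_def)
  define A where "A = {x \<in> space M. c < C x}"
  have A: "A \<in> sets F" unfolding A_def spaceF[symmetric] using CF by measurable
  then have AM: "A \<in> sets M" using sub by (auto simp: subalgebra_def)
  have "(\<integral>\<^sup>+x. indicator A x * C x \<partial>M) = (\<integral>\<^sup>+x. indicator A x * f x \<partial>M)"
    unfolding C_def using A True by (intro nn_cond_exp_intg) auto
  also have "\<dots> \<le> c * emeasure M A" by (rule le[OF True A])
  finally have *: "(\<integral>\<^sup>+x. indicator A x * C x \<partial>M) \<le> c * emeasure M A" .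
  have cA: "(\<integral>\<^sup>+x. indicator A x * c \<partial>M) = c * emeasure M A"
    using AM by (subst mult.commute) (rule nn_integral_cmult_indicator)
  have "(\<integral>\<^sup>+x. indicator A x * C x - indicator A x * c \<partial>M)
      = (\<integral>\<^sup>+x. indicator A x * C x \<partial>M) - (\<integral>\<^sup>+x. indicator A x * c \<partial>M)"
  proof (rule nn_integral_diff)
    show "(\<integral>\<^sup>+x. indicator A x * c \<partial>M) \<noteq> \<infinity>"
      unfolding cA using c by (simp add: ennreal_mult_eq_top_iff less_top)
    show "AE x in M. indicator A x * c \<le> indicator A x * C x"
      by (intro AE_I2) (auto simp: A_def split: split_indicator)
  qed (use AM CM in measurable)
  also have "\<dots> = 0"
  proof -
    have "emeasure M A < top"
      using emeasure_finite[of A] by (simp add: less_top[symmetric])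
    then have "c * emeasure M A < \<infinity>"
      using c by (simp add: ennreal_mult_less_top)
    with * show ?thesis by (simp add: cA diff_eq_0_iff_ennreal le_less_trans)
  qed
  finally have "AE x in M. indicator A x * C x - indicator A x * c = 0"
    using AM CM by (subst (asm) nn_integral_0_iff_AE) auto
  then have "AE x in M. C x \<le> c"
    using AE_space
  proof eventually_elim
    case (elim x)
    show ?case
    proof (rule ccontr)
      assume "\<not> C x \<le> c"
      then have "c < C x" "x \<in> A" using elim(2) by (auto simp: A_def)
      then show False using elim(1) diff_gr0_ennreal[of c "C x"] by simp
    qed
  qed
  then show ?thesis by (simp add: C_def)
qed (simp add: nn_cond_exp_def)

lemma ennreal_of_enat_le_tail_sum:
  "ennreal_of_enat x \<le> of_nat a + (\<Sum>j. if enat (a + j) < x then 1 else 0)"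
proof -
  have "(\<lambda>i. if enat i < x then 1 else 0 :: ennreal) sums ennreal_of_enat x"
    using sums_If_finite[of "\<lambda>r. enat r < x" "\<lambda>_. 1 :: ennreal"]
    by (cases x) (simp_all add: sums_def of_nat_tendsto_top_ennreal)
  then have "ennreal_of_enat x = (\<Sum>i. if enat i < x then 1 else 0)"
    by (simp add: sums_iff)
  also have "\<dots> = (\<Sum>j. if enat (j + a) < x then 1 else 0) + (\<Sum>i<a. if enat i < x then 1 else 0)"
    by (rule suminf_offset) simp
  also have "\<dots> \<le> (\<Sum>j. if enat (j + a) < x then 1 else 0) + (\<Sum>i<a. 1)"
    by (intro add_left_mono sum_mono) simp
  finally show ?thesis by (simp add: add.commute)
qed

text \<open>The Chernoff weight of the \<open>j\<close> increments following time \<open>t + 1\<close>.  The increment at \<open>t + 1\<close> is left out because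
  a chart that starts afresh at the change point \<open>t\<close> has its first reference value at time \<open>t + 1\<close>.\<close>
definition tilt :: "('a \<Rightarrow> real) \<Rightarrow> ('a \<Rightarrow> real) \<Rightarrow> real \<Rightarrow> nat \<Rightarrow> nat \<Rightarrow> (nat \<Rightarrow> 'a) \<Rightarrow> ennreal" where
  "tilt f0 f1 \<theta> t j \<xi> = (\<Prod>l\<in>{t+2..t+1+j}. ennreal (exp (- \<theta> * ln (f1 (\<xi> l) / f0 (\<xi> l)))))"

lemma tilt_Suc:
  "tilt f0 f1 \<theta> t (Suc j) \<xi> = tilt f0 f1 \<theta> t j \<xi> * ennreal (exp (- \<theta> * ln (f1 (\<xi> (t + 2 + j)) / f0 (\<xi> (t + 2 + j)))))"
  unfolding tilt_def by (simp add: mult.commute)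

text \<open>Without an alarm up to time \<open>t + 1 + j\<close>, the increments after \<open>t + 1\<close> sum to less than \<open>h\<close>; the observations up to
  time \<open>t + 1\<close> do not enter, so the bound is uniform in the past.\<close>
lemma one_le_tilt_if_no_alarm:
  assumes pos: "\<And>l. 1 \<le> l \<Longrightarrow> 0 < f0 (\<xi> l) \<and> 0 < f1 (\<xi> l)" and \<theta>: "0 < \<theta>"
    and no_alarm: "\<not> alarm_time f0 f1 h \<xi> \<le> enat (t + 1 + j)"
  shows "1 \<le> ennreal (exp (\<theta> * h)) * tilt f0 f1 \<theta> t j \<xi>"
proof -
  let ?S = "\<Sum>l=t+2..t+1+j. ln (f1 (\<xi> l) / f0 (\<xi> l))"
  have "\<not> ereal h \<le> cusum_y f0 f1 \<xi> (t + 1 + j)"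
    using no_alarm by (auto simp: alarm_time_le_iff)
  then have "\<forall>i\<in>{1..t+1+j}. \<not> h \<le> (\<Sum>l=i+1..t+1+j. ln (f1 (\<xi> l) / f0 (\<xi> l)))"
    using pos by (subst (asm) le_cusum_y_iff) auto
  from bspec[OF this, of "t + 1"] have "?S < h" by simp
  then have "0 \<le> \<theta> * (h - ?S)" using \<theta> by simp
  have "tilt f0 f1 \<theta> t j \<xi> = ennreal (\<Prod>l\<in>{t+2..t+1+j}. exp (- \<theta> * ln (f1 (\<xi> l) / f0 (\<xi> l))))"
    unfolding tilt_def by (rule prod_ennreal) simp
  also have "(\<Prod>l\<in>{t+2..t+1+j}. exp (- \<theta> * ln (f1 (\<xi> l) / f0 (\<xi> l)))) = exp (- \<theta> * ?S)"
    unfolding sum_distrib_left by (rule exp_sum[symmetric]) simp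
  finally have "tilt f0 f1 \<theta> t j \<xi> = ennreal (exp (- \<theta> * ?S))" .
  then have "ennreal (exp (\<theta> * h)) * tilt f0 f1 \<theta> t j \<xi> = ennreal (exp (\<theta> * (h - ?S)))"
    by (simp add: ennreal_mult''[symmetric] exp_add[symmetric] right_diff_distrib)
  also have "1 \<le> \<dots>"
    using \<open>0 \<le> \<theta> * (h - ?S)\<close> by (simp only: one_le_exp_iff ennreal_ge_1)
  finally show ?thesis .
qed

lemma (in honest_sensor) measurable_tilt:
  "(\<lambda>w. tilt f0 f1 \<theta> t j (w n)) \<in> borel_measurable (report_space \<mu> N)"
proof -
  have "(\<lambda>w. ennreal (exp (- \<theta> * ln (f1 (w n l) / f0 (w n l))))) \<in> borel_measurable (report_space \<mu> N)"
    if "1 \<le> l" for l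
  proof -
    have "(\<lambda>x. ennreal (exp (- \<theta> * ln (f1 x / f0 x)))) \<in> borel_measurable \<mu>" by measurable
    from measurable_compose[OF measurable_report[OF n that] this] show ?thesis .
  qed
  then show ?thesis unfolding tilt_def by (intro borel_measurable_prod_ennreal) auto
qed

text \<open>The increments after the change are independent of each other and of the past, so they
  are integrated out one at a time, the latest first.\<close>
lemma (in honest_sensor) nn_integral_tilt:
  assumes \<tau>: "\<tau> = enat t" and A: "A \<in> sets (report_filtration \<mu> N t)"
    and \<rho>: "\<rho> = (\<integral>\<^sup>+x. ennreal (exp (- \<theta> * ln (f1 x / f0 x))) \<partial>density \<mu> (\<lambda>x. ennreal (f1 x)))"
  shows "(\<integral>\<^sup>+w. indicator A w * tilt f0 f1 \<theta> t j (w n) \<partial>P) = emeasure P A * \<rho> ^ j"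
proof (induction j)
  case 0
  have "A \<in> sets P"
    using A subalgebra_report_filtration[of P \<mu> N t] by (auto simp: subalgebra_def)
  then show ?case by (simp add: tilt_def)
next
  case (Suc j)
  define F where "F w = indicator A w * tilt f0 f1 \<theta> t j (w n)" for w
  define G where "G x = ennreal (exp (- \<theta> * ln (f1 x / f0 x)))" for x
  have A': "A \<in> sets (report_space \<mu> N)"
    using A subalgebra_report_filtration[of P \<mu> N t] by (auto simp: subalgebra_def)
  have F: "F \<in> borel_measurable (report_space \<mu> N)"
    unfolding F_def using measurable_tilt A' by measurable
  have G: "G \<in> borel_measurable \<mu>" unfolding G_def by measurable
  have "(\<integral>\<^sup>+w. indicator A w * tilt f0 f1 \<theta> t (Suc j) (w n) \<partial>P) = (\<integral>\<^sup>+w. F w * G (w n (t + 2 + j)) \<partial>P)"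
    by (simp add: tilt_Suc F_def G_def mult.assoc)
  also have "\<dots> = (\<integral>\<^sup>+w. F w \<partial>P) * (\<integral>\<^sup>+x. G x \<partial>obs_law \<mu> f0 f1 \<tau> (t + 2 + j))"
  proof (rule nn_integral_mult_fresh[OF _ F G])
    fix w w' :: "nat \<Rightarrow> nat \<Rightarrow> 'a"
    assume w: "w \<in> space (report_space \<mu> N)" "w' \<in> space (report_space \<mu> N)"
      and eq: "\<And>m l. (m, l) \<noteq> (n, t + 2 + j) \<Longrightarrow> w m l = w' m l"
    have "w \<in> A \<longleftrightarrow> w' \<in> A"
      using eq by (intro report_filtration_depends_on_past[OF A w]) auto
    moreover have "tilt f0 f1 \<theta> t j (w n) = tilt f0 f1 \<theta> t j (w' n)"
      unfolding tilt_def using eq by (intro prod.cong) auto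
    ultimately show "F w = F w'" by (simp add: F_def indicator_def)
  qed simp
  also have "obs_law \<mu> f0 f1 \<tau> (t + 2 + j) = density \<mu> (\<lambda>x. ennreal (f1 x))"
    by (rule obs_law_after) (simp add: \<tau>)
  finally show ?case
    using Suc.IH unfolding F_def G_def \<rho> by (simp add: mult_ac)
qed

text \<open>Two honest sensors \<open>i\<close> and \<open>j\<close> exist since \<open>N \<ge> 3\<close>.  If the second alarm is missing, one of their alarms is
  missing.  The delay is at most \<open>b + 1\<close> plus the number of later times without a second alarm; each of these times
  is charged with two Chernoff weights, and the exponent \<open>b\<close> is chosen such that \<open>r ^ b\<close> compensates
  the factor \<open>exp (\<theta> * h)\<close>, which leaves \<open>2 * (1 + r + r^2 + ...)\<close>.\<close>
lemma delay_le:
  assumes N: "3 \<le> N" and f0: "prob_density \<mu> f0" and f1: "prob_density \<mu> f1"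
    and supp: "AE x in \<mu>. 0 < f0 x \<longleftrightarrow> 0 < f1 x"
    and \<theta>: "0 < \<theta>" and r: "0 < r" "r < 1"
    and moment: "(\<integral>\<^sup>+x. ennreal (exp (- \<theta> * ln (f1 x / f0 x))) \<partial>density \<mu> (\<lambda>x. ennreal (f1 x))) \<le> ennreal r"
    and b: "exp (\<theta> * h) * r ^ b \<le> 1"
  shows "delay \<mu> f0 f1 N (second_alarm f0 f1 N h) \<le> ennreal (real b + 1 + 2 / (1 - r))"
proof -
  let ?c = "ennreal (real b + 1 + 2 / (1 - r))"
  define \<rho> where "\<rho> = (\<integral>\<^sup>+x. ennreal (exp (- \<theta> * ln (f1 x / f0 x))) \<partial>density \<mu> (\<lambda>x. ennreal (f1 x)))"
  have "esssup (report_law \<mu> f0 f1 N (enat t) nc s)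
      (nn_cond_exp (report_law \<mu> f0 f1 N (enat t) nc s) (report_filtration \<mu> N t)
        (\<lambda>w. ennreal_of_enat (second_alarm f0 f1 N h w - enat t))) \<le> ?c"
    if nc: "nc \<in> {1..N}" and s: "s \<in> strategies \<mu>" for t nc s
  proof -
    define P where "P = report_law \<mu> f0 f1 N (enat t) nc s"
    define X where "X w = ennreal_of_enat (second_alarm f0 f1 N h w - enat t)" for w
    have "\<exists>i j. i \<in> {1..N} \<and> j \<in> {1..N} \<and> i \<noteq> j \<and> i \<noteq> nc \<and> j \<noteq> nc"
      by (intro exI[of _ "if nc = 1 then 2 else 1"] exI[of _ "if nc = 3 then 2 else 3"]) (use N nc in auto)
    then obtain i j where ij: "i \<in> {1..N}" "j \<in> {1..N}" "i \<noteq> j" "i \<noteq> nc" "j \<noteq> nc" by blast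
    interpret I: honest_sensor \<mu> f0 f1 N nc i "enat t" s
      using ij f0 f1 s nc by unfold_locales auto
    interpret J: honest_sensor \<mu> f0 f1 N nc j "enat t" s
      using ij f0 f1 s nc by unfold_locales auto
    interpret P: prob_space P unfolding P_def by (rule I.prob_space_P)
    have sub: "subalgebra P (report_filtration \<mu> N t)"
      unfolding P_def by (rule subalgebra_report_filtration) simp
    have obs_pos: "AE x in obs_law \<mu> f0 f1 (enat t) l. 0 < f0 x \<and> 0 < f1 x" for l
    proof (cases "enat l \<le> enat t")
      case True
      show ?thesis
        unfolding obs_law_before[OF True] by (subst AE_density) (use supp in \<open>auto elim: eventually_mono\<close>)
    next
      case False
      show ?thesis
        unfolding obs_law_after[OF False] by (subst AE_density) (use supp in \<open>auto elim: eventually_mono\<close>)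
    qed
    have good: "AE w in P. (\<forall>l\<ge>1. 0 < f0 (w i l) \<and> 0 < f1 (w i l)) \<and> (\<forall>l\<ge>1. 0 < f0 (w j l) \<and> 0 < f1 (w j l))"
      using I.AE_all_reports[OF obs_pos] J.AE_all_reports[OF obs_pos] unfolding P_def by auto
    define E where "E = ennreal (exp (\<theta> * h))"
    define W where "W w = of_nat (b + 1) + (\<Sum>k. E * (tilt f0 f1 \<theta> t (b + k) (w i) + tilt f0 f1 \<theta> t (b + k) (w j)))" for w
    have X_le_W: "AE w in P. X w \<le> W w"
      using good
    proof eventually_elim
      case (elim w)
      have "(if enat (b + 1 + k) < second_alarm f0 f1 N h w - enat t then 1 else 0)
          \<le> E * (tilt f0 f1 \<theta> t (b + k) (w i) + tilt f0 f1 \<theta> t (b + k) (w j))" for k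
      proof (cases "enat (b + 1 + k) < second_alarm f0 f1 N h w - enat t")
        case True
        then have "\<not> second_alarm f0 f1 N h w \<le> enat (t + 1 + (b + k))"
          by (cases "second_alarm f0 f1 N h w") auto
        then consider "\<not> alarm_time f0 f1 h (w i) \<le> enat (t + 1 + (b + k))"
          | "\<not> alarm_time f0 f1 h (w j) \<le> enat (t + 1 + (b + k))"
          using second_alarm_leI[OF ij(1-3)] by blast
        then have "1 \<le> E * tilt f0 f1 \<theta> t (b + k) (w i) + E * tilt f0 f1 \<theta> t (b + k) (w j)"
        proof cases
          case 1
          from one_le_tilt_if_no_alarm[OF _ \<theta> this] elim show ?thesis
            unfolding E_def by (intro add_increasing2) auto
        next
          case 2
          from one_le_tilt_if_no_alarm[OF _ \<theta> this] elim show ?thesis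
            unfolding E_def by (intro add_increasing) auto
        qed
        with True show ?thesis by (simp add: distrib_left)
      qed simp
      then have "of_nat (b + 1) + (\<Sum>k. if enat (b + 1 + k) < second_alarm f0 f1 N h w - enat t then 1 else 0) \<le> W w"
        unfolding W_def by (intro add_left_mono suminf_le) auto
      with ennreal_of_enat_le_tail_sum[of "second_alarm f0 f1 N h w - enat t" "b + 1"]
      show ?case unfolding X_def by (rule order_trans)
    qed
    have W_int: "(\<integral>\<^sup>+w. indicator A w * W w \<partial>P) \<le> ?c * emeasure P A" if A: "A \<in> sets (report_filtration \<mu> N t)" for A
    proof -
      have AP: "A \<in> sets P" using A sub by (auto simp: subalgebra_def)
      define U where "U n k w = indicator A w * tilt f0 f1 \<theta> t (b + k) (w n)" for n k and w :: "nat \<Rightarrow> nat \<Rightarrow> 'a"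
      have tilt_meas: "(\<lambda>w. tilt f0 f1 \<theta> t k (w i)) \<in> borel_measurable P"
        "(\<lambda>w. tilt f0 f1 \<theta> t k (w j)) \<in> borel_measurable P" for k
        using I.measurable_tilt J.measurable_tilt unfolding P_def by (simp_all cong: measurable_cong_sets)
      have U_meas: "U i k \<in> borel_measurable P" "U j k \<in> borel_measurable P" for k
        unfolding U_def using tilt_meas AP by measurable
      have U_int: "(\<integral>\<^sup>+w. U i k w \<partial>P) \<le> emeasure P A * ennreal r ^ (b + k)"
        "(\<integral>\<^sup>+w. U j k w \<partial>P) \<le> emeasure P A * ennreal r ^ (b + k)" for k
        using I.nn_integral_tilt[OF refl A \<rho>_def, of "b + k"] J.nn_integral_tilt[OF refl A \<rho>_def, of "b + k"]
          moment[folded \<rho>_def]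
        unfolding U_def P_def by (simp_all add: mult_left_mono power_mono)
      have "(\<integral>\<^sup>+w. indicator A w * W w \<partial>P)
          = (\<integral>\<^sup>+w. of_nat (b + 1) * indicator A w + (\<Sum>k. E * (U i k w + U j k w)) \<partial>P)"
        by (intro nn_integral_cong) (auto simp: W_def U_def split: split_indicator)
      also have "\<dots> = (\<integral>\<^sup>+w. of_nat (b + 1) * indicator A w \<partial>P) + (\<integral>\<^sup>+w. (\<Sum>k. E * (U i k w + U j k w)) \<partial>P)"
      proof (rule nn_integral_add)
        note U_meas[measurable]
        show "(\<lambda>w. \<Sum>k. E * (U i k w + U j k w)) \<in> borel_measurable P" by measurable
      qed (use AP in simp)
      also have "(\<integral>\<^sup>+w. of_nat (b + 1) * indicator A w \<partial>P) = of_nat (b + 1) * emeasure P A"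
        by (rule nn_integral_cmult_indicator[OF AP])
      also have "(\<integral>\<^sup>+w. (\<Sum>k. E * (U i k w + U j k w)) \<partial>P) = (\<Sum>k. \<integral>\<^sup>+w. E * (U i k w + U j k w) \<partial>P)"
        using U_meas by (intro nn_integral_suminf) measurable
      also have "\<dots> = (\<Sum>k. E * ((\<integral>\<^sup>+w. U i k w \<partial>P) + (\<integral>\<^sup>+w. U j k w \<partial>P)))"
        using U_meas by (simp add: nn_integral_cmult nn_integral_add)
      also have "\<dots> \<le> (\<Sum>k. (ennreal (2 * r ^ k)) * emeasure P A)"
      proof (intro suminf_le)
        fix k
        have "E * ((\<integral>\<^sup>+w. U i k w \<partial>P) + (\<integral>\<^sup>+w. U j k w \<partial>P))
            \<le> E * (emeasure P A * ennreal r ^ (b + k) + emeasure P A * ennreal r ^ (b + k))"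
          by (intro mult_left_mono add_mono U_int) simp
        also have "\<dots> = ennreal (2 * (exp (\<theta> * h) * r ^ b) * r ^ k) * emeasure P A"
          using r unfolding E_def P.emeasure_eq_measure
          by (simp add: ennreal_power ennreal_mult[symmetric] ennreal_plus[symmetric] power_add mult_ac del: ennreal_plus)
        also have "\<dots> \<le> ennreal (2 * r ^ k) * emeasure P A"
        proof (rule mult_right_mono[OF ennreal_leI])
          show "2 * (exp (\<theta> * h) * r ^ b) * r ^ k \<le> 2 * r ^ k"
            using mult_right_mono[OF b, of "2 * r ^ k"] r by (simp add: mult_ac)
        qed simp
        finally show "E * ((\<integral>\<^sup>+w. U i k w \<partial>P) + (\<integral>\<^sup>+w. U j k w \<partial>P)) \<le> ennreal (2 * r ^ k) * emeasure P A" .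
      qed simp_all
      also have "\<dots> = (\<Sum>k. ennreal (2 * r ^ k)) * emeasure P A" by (rule ennreal_suminf_multc)
      also have "(\<Sum>k. ennreal (2 * r ^ k)) = ennreal (2 / (1 - r))"
      proof -
        have "(\<lambda>k. 2 * r ^ k) sums (2 * (1 / (1 - r)))"
          using r by (intro sums_mult geometric_sums) simp
        then show ?thesis
          using r by (intro suminf_ennreal_eq) simp_all
      qed
      finally have "(\<integral>\<^sup>+w. indicator A w * W w \<partial>P) \<le> of_nat (b + 1) * emeasure P A + ennreal (2 / (1 - r)) * emeasure P A"
        by (simp add: add_left_mono)
      also have "of_nat (b + 1) = ennreal (real b + 1)"
        unfolding ennreal_of_nat_eq_real_of_nat by simp
      also have "ennreal (real b + 1) * emeasure P A + ennreal (2 / (1 - r)) * emeasure P A = ?c * emeasure P A"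
        unfolding distrib_right[symmetric] using r by (subst ennreal_plus[symmetric]) auto
      finally show ?thesis .
    qed
    have "AE w in P. nn_cond_exp P (report_filtration \<mu> N t) X w \<le> ?c"
    proof (rule nn_cond_exp_le_const[OF P.finite_measure_axioms sub])
      fix A assume A: "A \<in> sets (report_filtration \<mu> N t)"
      have "(\<integral>\<^sup>+w. indicator A w * X w \<partial>P) \<le> (\<integral>\<^sup>+w. indicator A w * W w \<partial>P)"
        using X_le_W by (intro nn_integral_mono_AE) (auto elim!: eventually_mono intro: mult_left_mono)
      also have "\<dots> \<le> ?c * emeasure P A" by (rule W_int[OF A])
      finally show "(\<integral>\<^sup>+w. indicator A w * X w \<partial>P) \<le> ?c * emeasure P A" .
    qed simp
    then show ?thesis
      unfolding P_def X_def by (intro esssup_I borel_measurable_nn_cond_exp2)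
  qed
  then show ?thesis
    unfolding delay_def by (intro SUP_least) auto
qed

section \<open>The delay against the average run length\<close>

theorem theorem4p1:
  fixes \<mu> :: "'a measure" and f0 f1 :: "'a \<Rightarrow> real" and N :: nat and \<kappa>1 R1 :: real
  assumes "3 \<le> N"
    and "sigma_finite_measure \<mu>"
    and "prob_density \<mu> f0" and "prob_density \<mu> f1"
    and "\<not> (AE x in \<mu>. f0 x = f1 x)"
    and "(\<integral>\<^sup>+x. e2ennreal ((llr f0 f1 x)\<^sup>2) \<partial>density \<mu> (\<lambda>x. ennreal (f1 x))) < \<infinity>"
    and "(mean_excess \<mu> f0 f1 \<longlongrightarrow> \<kappa>1) at_top"
    and "(mean_exp_excess \<mu> f0 f1 \<longlongrightarrow> R1) at_top"
  shows "\<exists>\<epsilon> :: real \<Rightarrow> real. (\<epsilon> \<longlongrightarrow> 0) at_top \<and>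
    (\<forall>\<^sub>F h in at_top.
       enn2ereal (delay \<mu> f0 f1 N (second_alarm f0 f1 N h)) \<le>
         ereal (2 / KL \<mu> f1 f0) *
           (elog (ARL \<mu> f0 f1 N (second_alarm f0 f1 N h)) +
            ereal (ln ((1 - exp (1 - real N)) * R1\<^sup>2 * KL \<mu> f1 f0 / exp (1 - real N))
                   + mean_min \<mu> f0 f1 + \<kappa>1))
         + ereal (\<epsilon> h))"
proof -
  note N = assms(1) and f0 = assms(3) and f1 = assms(4)
  have N2: "2 \<le> N" using N by simp
  interpret llr_moments \<mu> f0 f1
    using f0 f1 assms(6) by unfold_locales
  define D where "D = KL \<mu> f1 f0"
  have D: "0 < D" unfolding D_def by (rule KL_pos[OF assms(5)])
  define C where "C = ln ((1 - exp (1 - real N)) * R1\<^sup>2 * D / exp (1 - real N)) + mean_min \<mu> f0 f1 + \<kappa>1"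
  let ?d = "\<lambda>h. delay \<mu> f0 f1 N (second_alarm f0 f1 N h)"
  let ?ARL = "\<lambda>h. ARL \<mu> f0 f1 N (second_alarm f0 f1 N h)"
  \<comment> \<open>The inequality holds without error term for large \<open>h\<close>.\<close>
  have "\<forall>\<^sub>F h in at_top. enn2ereal (?d h) \<le> ereal (2 / D) * (elog (?ARL h) + ereal C) + ereal 0"
  proof (cases "AE x in \<mu>. 0 < f0 x \<longrightarrow> 0 < f1 x")
    case False
    have "\<forall>\<^sub>F h in at_top. (0 :: real) < h" by (rule eventually_gt_at_top)
    then show ?thesis
    proof eventually_elim
      case (elim h)
      then have "?ARL h = \<infinity>" by (rule ARL_infinite[OF N2 f0 f1 False])
      then have "ereal (2 / D) * (elog (?ARL h) + ereal C) = \<infinity>"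
        using D by (simp add: elog_def)
      then show ?case by (simp only: plus_ereal.simps ereal_less_eq)
    qed
  next
    case True
    obtain \<theta> where \<theta>: "0 < \<theta>"
      and mom: "(\<integral>\<^sup>+x. ennreal (exp (- \<theta> * g x)) \<partial>M1) \<le> ennreal (exp (- (2 / 3) * \<theta> * D))"
      using exponential_moment_bound D unfolding D_def by blast
    define r where "r = exp (- (2 / 3) * \<theta> * D)"
    have r: "0 < r" "r < 1" using \<theta> D by (auto simp: r_def)
    have supp: "AE x in \<mu>. 0 < f0 x \<longleftrightarrow> 0 < f1 x"
      using True AE_f0_pos by eventually_elim blast
    \<comment> \<open>The additive constants to be absorbed by the gap \<open>h / (2 * D)\<close> between \<open>2 * h / D\<close> and \<open>3 * h / (2 * D)\<close>.\<close>
    define C' where "C' = 2 + 2 / (1 - r) + 2 / D * (ln (8 * real N) - C)"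
    have "\<forall>\<^sub>F h in at_top. 0 < h \<and> 4 * real N \<le> exp h \<and> 2 * C' * D \<le> h"
      by (intro eventually_conj eventually_gt_at_top eventually_ge_at_top
          eventually_compose_filterlim[OF eventually_ge_at_top exp_at_top])
    then show ?thesis
    proof eventually_elim
      case (elim h)
      \<comment> \<open>The least integer with \<open>exp (\<theta> * h) * r ^ b \<le> 1\<close>.\<close>
      define b where "b = nat \<lceil>3 * h / (2 * D)\<rceil>"
      have "0 \<le> 3 * h / (2 * D)" using elim D by simp
      then have b: "3 * h / (2 * D) \<le> real b" "real b \<le> 3 * h / (2 * D) + 1"
        unfolding b_def by linarith+
      have "exp (\<theta> * h) * r ^ b = exp (\<theta> * h - real b * (2 / 3 * \<theta> * D))"
        by (simp add: r_def exp_of_nat_mult[symmetric] exp_add[symmetric])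
      also have "\<dots> \<le> 1"
      proof -
        have "3 * h \<le> real b * (2 * D)" using b(1) D by (simp add: field_simps)
        then have "\<theta> * (3 * h) \<le> \<theta> * (real b * (2 * D))" using \<theta> by (intro mult_left_mono) auto
        then show ?thesis by (simp add: field_simps)
      qed
      finally have bexp: "exp (\<theta> * h) * r ^ b \<le> 1" .
      have "?d h \<le> ennreal (real b + 1 + 2 / (1 - r))"
        by (rule delay_le[OF N f0 f1 supp \<theta> r mom[folded r_def] bexp])
      then have "enn2ereal (?d h) \<le> ereal (real b + 1 + 2 / (1 - r))"
        using r by (metis enn2ereal_ennreal less_eq_ennreal.rep_eq add_nonneg_nonneg of_nat_0_le_iff zero_le_one
          divide_nonneg_pos diff_gt_0_iff_gt zero_le_numeral)
      also have "real b + 1 + 2 / (1 - r) \<le> 2 / D * (h - ln (8 * real N) + C)"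
      proof -
        have combine: "x + 1 + q \<le> z" if "x \<le> u + 1" "2 + q + p \<le> v" "z = w - p" "w = u + v"
          for x u q p v z w :: real
          using that by linarith
        show ?thesis
        proof (rule combine[OF b(2)])
          show "2 + 2 / (1 - r) + 2 / D * (ln (8 * real N) - C) \<le> h / (2 * D)"
            using elim D unfolding C'_def[symmetric] by (simp add: field_simps)
          show "2 / D * (h - ln (8 * real N) + C) = 2 / D * h - 2 / D * (ln (8 * real N) - C)"
            by (simp add: algebra_simps add_divide_distrib)
          show "2 / D * h = 3 * h / (2 * D) + h / (2 * D)"
            using D by (simp add: field_simps)
        qed
      qed
      also have "ereal (2 / D * (h - ln (8 * real N) + C)) = ereal (2 / D) * (ereal (h - ln (8 * real N)) + ereal C)"
        by simp
      also have "\<dots> \<le> ereal (2 / D) * (elog (?ARL h) + ereal C)"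
      proof -
        have Npos: "0 < real N" using N by simp
        have ge: "ennreal (exp h / (8 * real N)) \<le> ?ARL h"
          using elim by (intro ARL_ge[OF N2 f0 f1 True]) auto
        have "ereal (h - ln (8 * real N)) \<le> elog (?ARL h)"
        proof (cases "?ARL h")
          case (real a)
          then have a: "exp h / (8 * real N) \<le> a" using ge by (simp add: ennreal_le_iff)
          have "0 < exp h / (8 * real N)" using Npos by simp
          with a have "0 < a" by linarith
          have "h - ln (8 * real N) = ln (exp h / (8 * real N))"
            using Npos by (subst ln_div) auto
          also have "\<dots> \<le> ln a" using a \<open>0 < a\<close> \<open>0 < exp h / (8 * real N)\<close> by (subst ln_le_cancel_iff) auto
          finally show ?thesis using real \<open>0 < a\<close> by (simp add: elog_def)
        next
          case top
          then show ?thesis by (simp add: elog_def)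
        qed
        then show ?thesis
          using D by (intro ereal_mult_left_mono add_right_mono) auto
      qed
      finally show ?case by simp
    qed
  qed
  then show ?thesis
    unfolding C_def D_def by (intro exI[of _ "\<lambda>_. 0"]) simp
qed

end
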